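(* Let $S=\langle d_1,\dots,d_m\rangle$ be a numerical semigroup with minimal generators $d_1<d_2<\cdots<d_m$ and $\gcd(d_1,\dots,d_m)=1$, and let $\beta_{k,j}=\beta_{k,j}(S)$ be its graded Betti numbers. For an integer $q\geq 1$ let $w_q$ be the number of indices $l\in\{1,\dots,m\}$ such that $q$ divides $d_l$. Then for all integers $q$ and $n$ such that $1\le q\le d_m$, $\gcd(n,q)=1$ and $w_q>0$, one has $$\sum_{k=0}^{m-1}\sum_{j}(-1)^k\beta_{k,j}\,j^r\,e^{\mathrm{i}\frac{2\pi n}{q}j}=0\qquad\text{for } r=0,1,\dots,w_q-1,$$ where $\mathrm{i}=\sqrt{-1}$ and, when $r=0$, $0^0$ is interpreted as $1$.
   Context: $\mathbb{N}=\{0,1,2,\dots\}$. A numerical semigroup is a submonoid of $(\mathbb{N},+)$ (containing $0$); it is finitely generated, $S=\langle d_1,\dots,d_m\rangle=\{\sum_{i=1}^m a_id_i : a_i\in\mathbb{N}\}$, with the $d_i$ positive integers. The generating set is minimal if no generator is a sum (with repetitions allowed) of the other generators. The condition $\gcd(d_1,\dots,d_m)=1$ is equivalent to $\mathbb{N}\setminus S$ being finite. Let $\mathbb{K}$ be a field, and let $R=\mathbb{K}[x_1,\dots,x_m]$ be graded by $\deg x_i=d_i$. The semigroup algebra $\mathbb{K}[S]=\mathbb{K}[t^s : s\in S]\subseteq\mathbb{K}[t]$, graded by $\deg t=1$, is a graded $R$-module via $x_i\mapsto t^{d_i}$. The graded Betti number is $\beta_{k,j}(S)=\dim_{\mathbb{K}}\operatorname{Tor}_k^R(\mathbb{K}[S],\mathbb{K})_j$,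 i.e. the number of minimal generators of degree $j$ of the $k$-th free module in the minimal graded free resolution of $\mathbb{K}[S]$ over $R$. The index $j$ in the sums runs over all degrees $j\in\mathbb{N}$ (only finitely many terms are nonzero).
   Formalization: The case q = 1, r = w_1 − 1 = m − 1 is excluded, because the identity is always false there: the sum equals (−1)^{m−1}(m−1)! d_1⋯d_m ≠ 0 (for S = ⟨2,3⟩ and r = 1 it is −6). All other q, n, r are covered. *)

theory Defs
  imports
    Complex_Main
    "HOL-Library.Poly_Mapping"
    "HOL-Computational_Algebra.Polynomial"
    "Jordan_Normal_Form.Matrix"
begin

section \<open>Numerical semigroups\<close>

definition generated :: "(nat \<Rightarrow> nat) \<Rightarrow> nat set \<Rightarrow> nat set" where
  "generated d I = {\<Sum>i\<in>I. a i * d i | a :: nat \<Rightarrow> nat. True}"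

definition minimally_generates :: "(nat \<Rightarrow> nat) \<Rightarrow> nat \<Rightarrow> nat set \<Rightarrow> bool" where
  "minimally_generates d m S \<longleftrightarrow>
     (\<forall>i\<in>{1..m}. 0 < d i) \<and>
     S = generated d {1..m} \<and>
     (\<forall>i\<in>{1..m}. d i \<notin> generated d ({1..m} - {i}))"

definition w :: "(nat \<Rightarrow> nat) \<Rightarrow> nat \<Rightarrow> nat \<Rightarrow> nat" where
  "w d m q = card {l \<in> {1..m}. q dvd d l}"

text \<open>The identities of the theorem equate to zero the derivatives \<open>(z d/dz)^r\<close> of
  \<open>P(z) = \<Sum>\<^sub>k \<Sum>\<^sub>j (-1)^k \<beta>\<^sub>k\<^sub>j z^j = H(z) \<Prod>\<^sub>i (1 - z^(d i))\<close> at a primitive \<open>q\<close>-th root of unity, where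
  the product vanishes to order \<open>w d m q\<close>. The Hilbert series \<open>H\<close> of \<open>K[S]\<close> has a simple pole at
  \<open>z = 1\<close>, so for \<open>q = 1\<close> (where \<open>w d m 1 = m\<close>) the identity holds for \<open>r < m - 1\<close>, but for
  \<open>r = m - 1\<close> the value is \<open>(-1)^(m-1) (m-1)! \<Prod>\<^sub>i d i\<close>, not zero. The theorem therefore excludes
  the pair \<open>q = 1\<close>, \<open>r = m - 1\<close>, and only that pair.\<close>

section \<open>The graded polynomial ring and the semigroup algebra\<close>

text \<open>A polynomial maps exponent vectors to coefficients. The ring
  \<open>R = K[x\<^sub>1, \<dots>, x\<^sub>m]\<close> is the subset \<open>poly_ring m\<close> of the type, which has a
  variable for every natural number.\<close>

type_synonym 'k mpoly = "(nat \<Rightarrow>\<^sub>0 nat) \<Rightarrow>\<^sub>0 'k"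

definition poly_ring :: "nat \<Rightarrow> 'k::field mpoly set" where
  "poly_ring m = {p. \<forall>a\<in>Poly_Mapping.keys p. Poly_Mapping.keys a \<subseteq> {1..m}}"

definition irrelevant_ideal :: "nat \<Rightarrow> 'k::field mpoly set" where
  "irrelevant_ideal m = {p \<in> poly_ring m. Poly_Mapping.lookup p 0 = 0}"

definition wdeg :: "(nat \<Rightarrow> nat) \<Rightarrow> (nat \<Rightarrow>\<^sub>0 nat) \<Rightarrow> nat" where
  "wdeg d a = (\<Sum>i\<in>Poly_Mapping.keys a. Poly_Mapping.lookup a i * d i)"

definition semigroup_algebra :: "nat set \<Rightarrow> 'k::field poly set" where
  "semigroup_algebra S = {f. \<forall>s. poly.coeff f s \<noteq> 0 \<longrightarrow> s \<in> S}"

text \<open>The ring homomorphism \<open>x\<^sub>i \<mapsto> t^(d i)\<close>, through which \<open>p \<in> R\<close> acts on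
  \<open>K[S]\<close> as multiplication by \<open>subst d p\<close>.\<close>

definition subst :: "(nat \<Rightarrow> nat) \<Rightarrow> 'k::field mpoly \<Rightarrow> 'k poly" where
  "subst d p = (\<Sum>a\<in>Poly_Mapping.keys p. Polynomial.monom (Poly_Mapping.lookup p a) (wdeg d a))"

section \<open>Minimal graded free resolutions and graded Betti numbers\<close>

text \<open>The \<open>k\<close>-th module \<open>F\<^sub>k\<close> of a resolution is given by the list \<open>e k\<close> of the degrees of
  its homogeneous basis elements, that is, \<open>F\<^sub>k\<close> is the direct sum of the \<open>R(-j)\<close> for \<open>j\<close> in
  \<open>e k\<close>. Its elements are the column vectors over \<open>R\<close> of length \<open>length (e k)\<close>.\<close>

definition free_module :: "nat \<Rightarrow> nat \<Rightarrow> 'k::field mpoly vec set" where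
  "free_module m b = {v \<in> carrier_vec b. \<forall>i<b. v $ i \<in> poly_ring m}"

text \<open>A matrix over \<open>R\<close> defines a degree-preserving map between graded free modules with
  basis degrees \<open>es\<close> (source) and \<open>es'\<close> (target) if its entry at \<open>(i, j)\<close> is homogeneous of
  degree \<open>es ! j - es' ! i\<close>, and hence zero if this number is negative.\<close>

definition graded_matrix ::
    "(nat \<Rightarrow> nat) \<Rightarrow> nat \<Rightarrow> nat list \<Rightarrow> nat list \<Rightarrow> 'k::field mpoly mat \<Rightarrow> bool" where
  "graded_matrix d m es es' A \<longleftrightarrow>
     A \<in> carrier_mat (length es') (length es) \<and>
     (\<forall>i<length es'. \<forall>j<length es. A $$ (i, j) \<in> poly_ring m \<and>
        (\<forall>a\<in>Poly_Mapping.keys (A $$ (i, j)). es' ! i + wdeg d a = es ! j))"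

text \<open>The \<open>R\<close>-linear map from \<open>F\<^sub>0\<close> to \<open>K[S]\<close> that sends the \<open>i\<close>-th basis element to \<open>g ! i\<close>.\<close>

definition augmentation :: "(nat \<Rightarrow> nat) \<Rightarrow> 'k::field poly list \<Rightarrow> 'k mpoly vec \<Rightarrow> 'k poly" where
  "augmentation d g v = (\<Sum>i<length g. subst d (v $ i) * g ! i)"

text \<open>\<open>D k\<close> is the matrix of the differential from \<open>F\<^bsub>k+1\<^esub>\<close> to \<open>F\<^sub>k\<close>. All \<open>F\<^sub>k\<close> have finite
  rank, but no bound on the length of the resolution is imposed.\<close>

definition graded_free_resolution ::
    "(nat \<Rightarrow> nat) \<Rightarrow> nat \<Rightarrow> nat set \<Rightarrow>
     (nat \<Rightarrow> nat list) \<Rightarrow> (nat \<Rightarrow> 'k::field mpoly mat) \<Rightarrow> 'k poly list \<Rightarrow> bool" where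
  "graded_free_resolution d m S e D g \<longleftrightarrow>
     length g = length (e 0) \<and>
     (\<forall>i<length g. g ! i \<in> semigroup_algebra S \<and>
        (\<forall>s. poly.coeff (g ! i) s \<noteq> 0 \<longrightarrow> s = e 0 ! i)) \<and>
     (\<forall>k. graded_matrix d m (e (Suc k)) (e k) (D k)) \<and>
     augmentation d g ` free_module m (length (e 0)) = semigroup_algebra S \<and>
     {v \<in> free_module m (length (e 0)). augmentation d g v = 0} =
        (\<lambda>u. D 0 *\<^sub>v u) ` free_module m (length (e 1)) \<and>
     (\<forall>k. {v \<in> free_module m (length (e (Suc k))). D k *\<^sub>v v = 0\<^sub>v (length (e k))} =
        (\<lambda>u. D (Suc k) *\<^sub>v u) ` free_module m (length (e (Suc (Suc k)))))"

definition minimal_graded_free_resolution ::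
    "(nat \<Rightarrow> nat) \<Rightarrow> nat \<Rightarrow> nat set \<Rightarrow>
     (nat \<Rightarrow> nat list) \<Rightarrow> (nat \<Rightarrow> 'k::field mpoly mat) \<Rightarrow> 'k poly list \<Rightarrow> bool" where
  "minimal_graded_free_resolution d m S e D g \<longleftrightarrow>
     graded_free_resolution d m S e D g \<and>
     (\<forall>k. \<forall>i<length (e k). \<forall>j<length (e (Suc k)). D k $$ (i, j) \<in> irrelevant_ideal m)"

text \<open>If \<open>e\<close> belongs to a minimal graded free resolution of \<open>K[S]\<close>, this is the number of
  minimal generators of degree \<open>j\<close> of its \<open>k\<close>-th module, which is the dimension of
  \<open>Tor\<^sub>k(K[S], K)\<^sub>j\<close>, because the differentials vanish after tensoring with \<open>K\<close>.\<close>

definition betti :: "(nat \<Rightarrow> nat list) \<Rightarrow> nat \<Rightarrow> nat \<Rightarrow> nat" where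
  "betti e k j = card {i. i < length (e k) \<and> e k ! i = j}"

lemma finite_betti_support: "finite {j. betti e k j \<noteq> 0}"
proof (rule finite_subset)
  show "{j. betti e k j \<noteq> 0} \<subseteq> set (e k)"
    by (auto simp: betti_def card_eq_0_iff)
qed simp

end

theory Submission
  imports Defs "HOL-Library.Function_Algebras" "HOL-Computational_Algebra.Polynomial_FPS"
begin

text \<open>Reducing a minimal complex modulo a variable preserves exactness in homological degrees at
  least 2, hence by induction a minimal resolution over \<open>n\<close> variables has length at most \<open>n\<close>.
  As \<open>K[S]\<close> is a domain, one variable can be removed without losing a degree, so
  \<open>F\<^sub>k = 0\<close> for \<open>k \<ge> m\<close>. Counting dimensions in each degree gives
  \<open>P(z) = \<Sum>\<^sub>k \<Sum>\<^sub>j (-1)^k \<beta>\<^sub>k\<^sub>j z^j = H(z) \<Prod>\<^sub>i (1 - z^(d i))\<close>, where \<open>H\<close> is the Hilbert series of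
  \<open>K[S]\<close>. For each index \<open>l\<close>, \<open>(1 - z^(d l)) H(z)\<close> is a polynomial, hence \<open>P\<close> is divisible by
  \<open>\<Prod>\<^bsub>i \<noteq> l\<^esub> (1 - z^(d i))\<close>. If \<open>q > 1\<close>, some \<open>d l\<close> is not divisible by \<open>q\<close>, and then this product
  vanishes to order \<open>w d m q\<close> at a \<open>q\<close>-th root of unity; for \<open>q = 1\<close> the order is \<open>m - 1\<close>.\<close>

abbreviation "keys \<equiv> Poly_Mapping.keys"
abbreviation "lookup \<equiv> Poly_Mapping.lookup"

section \<open>Restricting a polynomial to a set of monomials\<close>

text \<open>Serves two purposes: setting a variable to zero and extracting a homogeneous
  component.\<close>

lift_definition restr :: "('a \<Rightarrow> bool) \<Rightarrow> ('a \<Rightarrow>\<^sub>0 'b::zero) \<Rightarrow> 'a \<Rightarrow>\<^sub>0 'b"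
  is "\<lambda>P f a. if P a then f a else 0"
  by (rule finite_subset) auto

lemma lookup_restr: "lookup (restr P p) a = (if P a then lookup p a else 0)"
  by transfer simp

lemma keys_restr: "keys (restr P p) = {a \<in> keys p. P a}"
  by transfer auto

lemma restr_zero [simp]: "restr P 0 = 0"
  by (rule poly_mapping_eqI) (simp add: lookup_restr)

lemma restr_add:
  fixes p q :: "'a \<Rightarrow>\<^sub>0 'b::monoid_add"
  shows "restr P (p + q) = restr P p + restr P q"
  by (rule poly_mapping_eqI) (simp add: lookup_restr lookup_add)

lemma restr_sum:
  fixes f :: "'c \<Rightarrow> 'a \<Rightarrow>\<^sub>0 'b::comm_monoid_add"
  shows "restr P (sum f I) = (\<Sum>i\<in>I. restr P (f i))"
  by (induction I rule: infinite_finite_induct) (simp_all add: restr_add)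

lemma restr_eq_self: "(\<And>a. a \<in> keys p \<Longrightarrow> P a) \<Longrightarrow> restr P p = p"
  by (rule poly_mapping_eqI) (auto simp: lookup_restr in_keys_iff)

lemma restr_eq_zero: "(\<And>a. a \<in> keys p \<Longrightarrow> \<not> P a) \<Longrightarrow> restr P p = 0"
  by (rule poly_mapping_eqI) (auto simp: lookup_restr in_keys_iff)

lemma restr_split:
  fixes p :: "'a \<Rightarrow>\<^sub>0 'b::monoid_add"
  shows "p = restr P p + restr (\<lambda>a. \<not> P a) p"
  by (rule poly_mapping_eqI) (simp add: lookup_restr lookup_add)

text \<open>Whether a product \<open>a + b\<close> of monomials survives depends on \<open>b\<close>
  alone, so the restriction can be moved to the factor \<open>q\<close>.\<close>

lemma restr_mult:
  fixes p q :: "'a::monoid_add \<Rightarrow>\<^sub>0 'b::semiring_0"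
  assumes "\<And>a b. a \<in> keys p \<Longrightarrow> P (a + b) \<longleftrightarrow> Q b"
  shows "restr P (p * q) = p * restr Q q"
proof -
  have "p * q = p * restr Q q + p * restr (\<lambda>a. \<not> Q a) q"
    by (subst (1) restr_split[of q Q]) (simp add: distrib_left)
  moreover have "restr P (p * restr Q q) = p * restr Q q"
    by (rule restr_eq_self) (use keys_mult[of p "restr Q q"] assms in \<open>auto simp: keys_restr\<close>)
  moreover have "restr P (p * restr (\<lambda>a. \<not> Q a) q) = 0"
    by (rule restr_eq_zero)
      (use keys_mult[of p "restr (\<lambda>a. \<not> Q a) q"] assms in \<open>auto simp: keys_restr\<close>)
  ultimately show ?thesis by (simp add: restr_add)
qed

section \<open>The polynomial ring\<close>

lemma sum_single_keys: "(\<Sum>a\<in>keys p. Poly_Mapping.single a (lookup p a)) = p"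
  by (intro poly_mapping_eqI)
    (simp add: lookup_sum lookup_single when_def sum.If_cases if_distrib in_keys_iff cong: if_cong)

lemma keys_add_nat:
  fixes a b :: "'a \<Rightarrow>\<^sub>0 nat"
  shows "keys (a + b) = keys a \<union> keys b"
  by (auto simp: in_keys_iff lookup_add)

lemma keys_diff:
  fixes p q :: "'a \<Rightarrow>\<^sub>0 'b::ab_group_add"
  shows "keys (p - q) \<subseteq> keys p \<union> keys q"
  by (auto simp: in_keys_iff lookup_minus)

lemma poly_ring_zero [simp]: "0 \<in> poly_ring n"
  by (simp add: poly_ring_def)

lemma poly_ring_add: "p \<in> poly_ring n \<Longrightarrow> q \<in> poly_ring n \<Longrightarrow> p + q \<in> poly_ring n"
  using keys_add[of p q] by (fastforce simp: poly_ring_def)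

lemma poly_ring_mult: "p \<in> poly_ring n \<Longrightarrow> q \<in> poly_ring n \<Longrightarrow> p * q \<in> poly_ring n"
  using keys_mult[of p q] by (fastforce simp: poly_ring_def keys_add_nat)

lemma poly_ring_diff: "p \<in> poly_ring n \<Longrightarrow> q \<in> poly_ring n \<Longrightarrow> p - q \<in> poly_ring n"
  using keys_diff[of p q] by (fastforce simp: poly_ring_def)

lemma poly_ring_sum: "(\<And>i. i \<in> I \<Longrightarrow> f i \<in> poly_ring n) \<Longrightarrow> sum f I \<in> poly_ring n"
  by (induction I rule: infinite_finite_induct) (simp_all add: poly_ring_add)

lemma poly_ring_restr: "p \<in> poly_ring n \<Longrightarrow> restr P p \<in> poly_ring n"
  by (auto simp: poly_ring_def keys_restr)

lemma poly_ring_mono: "n \<le> k \<Longrightarrow> poly_ring n \<subseteq> poly_ring k"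
  by (fastforce simp: poly_ring_def)

definition var :: "nat \<Rightarrow> 'k::field mpoly" where
  "var n = Poly_Mapping.single (Poly_Mapping.single n 1) 1"

lemma var_in_poly_ring: "n \<in> {1..m} \<Longrightarrow> var n \<in> poly_ring m"
  by (simp add: poly_ring_def var_def)

lemma var_neq_0 [simp]: "var n \<noteq> 0"
  unfolding var_def by (metis keys_single keys_zero insert_not_empty zero_neq_one)

text \<open>The quotient modulo a variable, realised as substituting 0 for it, so that the quotient
  ring stays inside the same type.\<close>

abbreviation reduce :: "nat \<Rightarrow> 'k::field mpoly \<Rightarrow> 'k mpoly" where
  "reduce n \<equiv> restr (\<lambda>a. lookup a n = 0)"

text \<open>The terms containing the variable form an ideal, so that part of \<open>p\<close>
  contributes nothing after reduction.\<close>

lemma reduce_mult: "reduce n (p * q) = reduce n p * reduce n q"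
proof -
  have "p * q = reduce n p * q + restr (\<lambda>a. lookup a n \<noteq> 0) p * q"
    by (subst (1) restr_split[of p "\<lambda>a. lookup a n = 0"]) (simp add: distrib_right)
  moreover have "reduce n (reduce n p * q) = reduce n p * reduce n q"
    by (rule restr_mult) (auto simp: keys_restr lookup_add)
  moreover have "reduce n (restr (\<lambda>a. lookup a n \<noteq> 0) p * q) = 0"
    by (rule restr_eq_zero)
      (use keys_mult[of "restr (\<lambda>a. lookup a n \<noteq> 0) p" q] in \<open>auto simp: keys_restr lookup_add\<close>)
  ultimately show ?thesis by (simp add: restr_add)
qed

lemma reduce_var [simp]: "reduce n (var n) = 0"
  by (rule restr_eq_zero) (auto simp: var_def split: if_splits)

lemma reduce_in_poly_ring: "p \<in> poly_ring (Suc n) \<Longrightarrow> reduce (Suc n) p \<in> poly_ring n"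
  unfolding poly_ring_def
proof (intro CollectI ballI subsetI)
  fix a i assume "p \<in> {p. \<forall>a\<in>keys p. keys a \<subseteq> {1..Suc n}}"
    and a: "a \<in> keys (reduce (Suc n) p)" and i: "i \<in> keys a"
  then have "i \<in> {1..Suc n}" unfolding keys_restr by blast
  moreover have "i \<noteq> Suc n" using a i by (auto simp: keys_restr in_keys_iff)
  ultimately show "i \<in> {1..n}" by auto
qed

lemma reduce_poly_ring: "p \<in> poly_ring n \<Longrightarrow> reduce (Suc n) p = p"
  by (rule restr_eq_self) (fastforce simp: poly_ring_def in_keys_iff)

lemma reduce_in_irrelevant_ideal:
  "p \<in> irrelevant_ideal (Suc n) \<Longrightarrow> reduce (Suc n) p \<in> irrelevant_ideal n"
  by (simp add: irrelevant_ideal_def reduce_in_poly_ring lookup_restr)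

text \<open>Every term of \<open>p\<close> contains the variable, so one power of it can be
  cancelled termwise.\<close>

lemma reduce_eq_0_imp_var_dvd:
  assumes "p \<in> poly_ring m" and "reduce n p = 0"
  obtains q where "q \<in> poly_ring m" and "p = var n * q"
proof
  define q where "q = (\<Sum>a\<in>keys p. Poly_Mapping.single (a - Poly_Mapping.single n 1) (lookup p a))"
  have pos: "lookup a n > 0" if "a \<in> keys p" for a
  proof (rule ccontr)
    assume "\<not> lookup a n > 0"
    with that have "a \<in> keys (reduce n p)" by (simp add: keys_restr)
    with assms(2) show False by simp
  qed
  have "var n * q = (\<Sum>a\<in>keys p. Poly_Mapping.single a (lookup p a))"
    unfolding q_def sum_distrib_left
  proof (rule sum.cong[OF refl])
    fix a assume "a \<in> keys p"
    \<comment> \<open>The exponent of the variable is positive, so the truncated subtraction is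
      exact.\<close>
    from pos[OF this] have "Poly_Mapping.single n 1 + (a - Poly_Mapping.single n 1) = a"
      by (intro poly_mapping_eqI) (auto simp: lookup_add lookup_minus lookup_single when_def)
    then show "var n * Poly_Mapping.single (a - Poly_Mapping.single n 1) (lookup p a)
        = Poly_Mapping.single a (lookup p a)"
      by (simp add: mult_single var_def)
  qed
  also have "\<dots> = p" by (rule sum_single_keys)
  finally show "p = var n * q" ..
  show "q \<in> poly_ring m"
    unfolding q_def
  proof (rule poly_ring_sum)
    fix a assume a: "a \<in> keys p"
    have "keys (a - Poly_Mapping.single n 1) \<subseteq> keys a"
      by (auto simp: in_keys_iff lookup_minus)
    with a assms(1) show "Poly_Mapping.single (a - Poly_Mapping.single n 1) (lookup p a) \<in> poly_ring m"
      by (auto simp: poly_ring_def)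
  qed
qed

section \<open>Vectors and matrices as functions\<close>

text \<open>Vectors of length \<open>b\<close> are extended by zero, so that they form a subset of an additive
  group type.\<close>

definition vecs :: "nat \<Rightarrow> nat \<Rightarrow> (nat \<Rightarrow> 'k::field mpoly) set" where
  "vecs n b = {v. \<forall>i. v i \<in> poly_ring n \<and> (b \<le> i \<longrightarrow> v i = 0)}"

definition app :: "nat \<Rightarrow> (nat \<Rightarrow> nat \<Rightarrow> 'k::field mpoly) \<Rightarrow> (nat \<Rightarrow> 'k mpoly) \<Rightarrow> nat \<Rightarrow> 'k mpoly" where
  "app b A v = (\<lambda>i. \<Sum>j<b. A i j * v j)"

lemma app_add: "app b A (\<lambda>i. u i + v i) = (\<lambda>i. app b A u i + app b A v i)"
  by (simp add: app_def distrib_left sum.distrib)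

lemma app_diff: "app b A (\<lambda>i. u i - v i) = (\<lambda>i. app b A u i - app b A v i)"
  by (simp add: app_def right_diff_distrib sum_subtractf)

lemma app_scale: "app b A (\<lambda>i. c * v i) = (\<lambda>i. c * app b A v i)"
  by (simp add: app_def sum_distrib_left ac_simps)

lemma app_reduce:
  "app b (\<lambda>i j. reduce n (A i j)) (\<lambda>i. reduce n (v i)) = (\<lambda>i. reduce n (app b A v i))"
  by (simp add: app_def restr_sum reduce_mult)

lemma app_in_vecs:
  assumes "\<And>i j. A i j \<in> poly_ring n" "\<And>i j. b' \<le> i \<Longrightarrow> A i j = 0" "v \<in> vecs n b"
  shows "app b A v \<in> vecs n b'"
  using assms by (auto simp: app_def vecs_def intro!: poly_ring_sum poly_ring_mult sum.neutral)

lemma reduce_eq_0_imp_var_dvd_vec: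
  assumes "v \<in> vecs m b" and "\<And>i. reduce n (v i) = 0"
  obtains u where "u \<in> vecs m b" and "v = (\<lambda>i. var n * u i)"
proof -
  have "\<exists>q. q \<in> poly_ring m \<and> v i = var n * q" for i
  proof -
    have "v i \<in> poly_ring m" using assms(1) by (simp add: vecs_def)
    then obtain q where "q \<in> poly_ring m" "v i = var n * q"
      using assms(2) by (rule reduce_eq_0_imp_var_dvd)
    then show ?thesis by blast
  qed
  then obtain u where u: "\<And>i. u i \<in> poly_ring m" "\<And>i. v i = var n * u i" by metis
  have "u \<in> vecs m b"
    using u assms(1) by (auto simp: vecs_def)
  moreover have "v = (\<lambda>i. var n * u i)" using u(2) by (rule ext)
  ultimately show ?thesis by (rule that)
qed

text \<open>Exactness at the middle of \<open>F\<^sub>2 \<rightarrow> F\<^sub>1 \<rightarrow> F\<^sub>0\<close> survives the reduction modulo a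
  variable that is regular on the cokernel of \<open>F\<^sub>1 \<rightarrow> F\<^sub>0\<close>.\<close>

lemma exact_reduce:
  assumes A1: "\<And>i j. A1 i j \<in> poly_ring (Suc n)" "\<And>i j. b0 \<le> i \<Longrightarrow> A1 i j = 0"
    and regular: "\<And>u. u \<in> vecs (Suc n) b0 \<Longrightarrow>
       (\<lambda>i. var (Suc n) * u i) \<in> app b1 A1 ` vecs (Suc n) b1 \<Longrightarrow> u \<in> app b1 A1 ` vecs (Suc n) b1"
    and exact: "\<And>v. v \<in> vecs (Suc n) b1 \<Longrightarrow> app b1 A1 v = 0 \<Longrightarrow> v \<in> app b2 A2 ` vecs (Suc n) b2"
    and v: "v \<in> vecs n b1" "app b1 (\<lambda>i j. reduce (Suc n) (A1 i j)) v = 0"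
  shows "v \<in> app b2 (\<lambda>i j. reduce (Suc n) (A2 i j)) ` vecs n b2"
proof -
  let ?R = "reduce (Suc n)" and ?X = "var (Suc n) :: 'a mpoly"
  have v': "v \<in> vecs (Suc n) b1"
    using v(1) poly_ring_mono[of n "Suc n"] by (auto simp: vecs_def)
  have Rv: "(\<lambda>i. ?R (v i)) = v"
    using v(1) by (auto simp: vecs_def reduce_poly_ring)
  have "?R (app b1 A1 v i) = 0" for i
    using app_reduce[of b1 "Suc n" A1 v] v(2) unfolding Rv by (simp add: fun_eq_iff)
  moreover have "app b1 A1 v \<in> vecs (Suc n) b0"
    by (rule app_in_vecs[OF A1 v'])
  ultimately obtain u where u: "u \<in> vecs (Suc n) b0" "app b1 A1 v = (\<lambda>i. ?X * u i)"
    using reduce_eq_0_imp_var_dvd_vec[of "app b1 A1 v" "Suc n" b0 "Suc n"] by blast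
  \<comment> \<open>The variable times \<open>u\<close> is a boundary, so regularity provides a
    preimage \<open>u'\<close> of \<open>u\<close>.\<close>
  have "u \<in> app b1 A1 ` vecs (Suc n) b1"
  proof (rule regular[OF u(1)])
    show "(\<lambda>i. ?X * u i) \<in> app b1 A1 ` vecs (Suc n) b1"
      unfolding u(2)[symmetric] using v' by (rule imageI)
  qed
  then obtain u' where u': "u' \<in> vecs (Suc n) b1" "u = app b1 A1 u'" by blast
  have X: "?X \<in> poly_ring (Suc n)" by (rule var_in_poly_ring) simp
  \<comment> \<open>\<open>v\<close> need not be a cycle before reduction. Subtracting this multiple
    of the variable makes it one, and reduction erases the correction.\<close>
  have "(\<lambda>i. v i - ?X * u' i) \<in> vecs (Suc n) b1"
    using v' u'(1) X by (auto simp: vecs_def intro!: poly_ring_diff poly_ring_mult)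
  moreover have "app b1 A1 (\<lambda>i. v i - ?X * u' i) = 0"
    by (simp add: app_diff app_scale u(2) u'(2) fun_eq_iff)
  ultimately obtain z where z: "z \<in> vecs (Suc n) b2" "(\<lambda>i. v i - ?X * u' i) = app b2 A2 z"
    using exact by blast
  have eq: "v i = ?X * u' i + app b2 A2 z i" for i
    using fun_cong[OF z(2), of i] by (simp add: algebra_simps)
  have "v i = ?R (app b2 A2 z i)" for i
  proof -
    have "v i = ?R (v i)" using fun_cong[OF Rv, of i] by simp
    also have "\<dots> = ?R (?X * u' i + app b2 A2 z i)" by (simp only: eq[of i])
    also have "\<dots> = ?R (app b2 A2 z i)" by (simp add: restr_add reduce_mult)
    finally show ?thesis .
  qed
  then have "v = app b2 (\<lambda>i j. ?R (A2 i j)) (\<lambda>i. ?R (z i))"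
    by (simp add: app_reduce fun_eq_iff)
  moreover have "(\<lambda>i. ?R (z i)) \<in> vecs n b2"
    using z(1) by (auto simp: vecs_def reduce_in_poly_ring)
  ultimately show ?thesis by blast
qed

section \<open>Hilbert's syzygy theorem for minimal complexes\<close>

text \<open>\<open>A k\<close> maps \<open>F\<^bsub>k+1\<^esub>\<close> to \<open>F\<^sub>k\<close>, where \<open>F\<^sub>k\<close> has rank \<open>b k\<close>; nothing is required at \<open>F\<^sub>0\<close>.\<close>

definition minimal_complex ::
    "nat \<Rightarrow> (nat \<Rightarrow> nat) \<Rightarrow> (nat \<Rightarrow> nat \<Rightarrow> nat \<Rightarrow> 'k::field mpoly) \<Rightarrow> bool" where
  "minimal_complex n b A \<longleftrightarrow>
     (\<forall>k i j. A k i j \<in> irrelevant_ideal n \<and> (b k \<le> i \<longrightarrow> A k i j = 0)) \<and>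
     (\<forall>k. \<forall>v\<in>vecs n (b (Suc (Suc k))). app (b (Suc k)) (A k) (app (b (Suc (Suc k))) (A (Suc k)) v) = 0)"

text \<open>Only kernel inside image is stated; the reverse inclusion is the composition condition
  of \<open>minimal_complex\<close>.\<close>

definition exact_complex ::
    "nat \<Rightarrow> (nat \<Rightarrow> nat) \<Rightarrow> (nat \<Rightarrow> nat \<Rightarrow> nat \<Rightarrow> 'k::field mpoly) \<Rightarrow> bool" where
  "exact_complex n b A \<longleftrightarrow>
     (\<forall>k. \<forall>v\<in>vecs n (b (Suc k)). app (b (Suc k)) (A k) v = 0 \<longrightarrow>
        v \<in> app (b (Suc (Suc k))) (A (Suc k)) ` vecs n (b (Suc (Suc k))))"

lemma minimal_complex_shift:
  "minimal_complex n b A \<Longrightarrow> minimal_complex n (\<lambda>k. b (Suc k)) (\<lambda>k. A (Suc k))"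
  by (auto simp: minimal_complex_def)

lemma minimal_complex_reduce:
  assumes "minimal_complex (Suc n) b A"
  shows "minimal_complex n b (\<lambda>k i j. reduce (Suc n) (A k i j))"
  unfolding minimal_complex_def
proof (intro conjI allI ballI impI)
  fix k and v :: "nat \<Rightarrow> 'a mpoly"
  assume v: "v \<in> vecs n (b (Suc (Suc k)))"
  then have Rv: "v = (\<lambda>i. reduce (Suc n) (v i))"
    by (auto simp: vecs_def reduce_poly_ring)
  have "v \<in> vecs (Suc n) (b (Suc (Suc k)))"
    using v poly_ring_mono[of n "Suc n"] by (auto simp: vecs_def)
  with assms have "app (b (Suc k)) (A k) (app (b (Suc (Suc k))) (A (Suc k)) v) = 0"
    by (simp add: minimal_complex_def)
  then show "app (b (Suc k)) (\<lambda>i j. reduce (Suc n) (A k i j))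
      (app (b (Suc (Suc k))) (\<lambda>i j. reduce (Suc n) (A (Suc k) i j)) v) = 0"
    by (subst Rv) (simp add: app_reduce fun_eq_iff)
qed (use assms in \<open>auto simp: minimal_complex_def reduce_in_irrelevant_ideal\<close>)

text \<open>Induction on the number of variables. Setting the last one to zero keeps minimality but
  may lose exactness in the lowest position; an index shift by one per variable accounts for
  this.\<close>

theorem syzygy:
  assumes "minimal_complex n b A" and "exact_complex n b A" and "n < k"
  shows "b k = 0"
  using assms
proof (induction n arbitrary: b A k)
  case 0
  then obtain l where k: "k = Suc l" by (cases k) auto
  \<comment> \<open>Without variables the irrelevant ideal is zero, so minimality kills every
    differential.\<close>
  have zero: "A k i j = 0" for k i j
  proof -
    have "A k i j \<in> irrelevant_ideal 0" using 0(1) by (simp add: minimal_complex_def)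
    then have sub: "keys (A k i j) \<subseteq> {0}" and "lookup (A k i j) 0 = 0"
      by (auto simp: irrelevant_ideal_def poly_ring_def)
    then have "lookup (A k i j) a = 0" for a
      by (cases "a = 0") (auto simp: in_keys_iff)
    then show ?thesis by (intro poly_mapping_eqI) simp
  qed
  show ?case
  proof (rule ccontr)
    assume "b k \<noteq> 0"
    \<comment> \<open>The first basis vector is a cycle because the differentials vanish, but for
      the same reason it is no boundary.\<close>
    define v :: "nat \<Rightarrow> 'a mpoly" where "v = (\<lambda>i. if i = 0 then 1 else 0)"
    have "v \<in> vecs 0 (b (Suc l))"
      using \<open>b k \<noteq> 0\<close> k by (auto simp: vecs_def v_def poly_ring_def)
    moreover have "app (b (Suc l)) (A l) v = 0"
      by (auto simp: app_def zero)
    ultimately have "v \<in> app (b (Suc (Suc l))) (A (Suc l)) ` vecs 0 (b (Suc (Suc l)))"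
      using 0(2) by (simp add: exact_complex_def)
    then have "v 0 = 0"
      by (auto simp: app_def zero)
    then show False by (simp add: v_def)
  qed
next
  case (Suc n)
  let ?A = "\<lambda>k i j. reduce (Suc n) (A (Suc k) i j)" and ?b = "\<lambda>k. b (Suc k)"
  have "minimal_complex n ?b ?A"
    using minimal_complex_reduce[OF minimal_complex_shift[OF Suc.prems(1)]] .
  moreover have "exact_complex n ?b ?A"
    unfolding exact_complex_def
  proof (intro allI ballI impI)
    fix k v
    assume v: "v \<in> vecs n (b (Suc (Suc k)))" "app (b (Suc (Suc k))) (?A k) v = 0"
    show "v \<in> app (b (Suc (Suc (Suc k)))) (?A (Suc k)) ` vecs n (b (Suc (Suc (Suc k))))"
    proof (rule exact_reduce[OF _ _ _ _ v])
      fix u :: "nat \<Rightarrow> 'a mpoly"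
      assume u: "u \<in> vecs (Suc n) (b (Suc k))"
        and im: "(\<lambda>i. var (Suc n) * u i) \<in> app (b (Suc (Suc k))) (A (Suc k)) ` vecs (Suc n) (b (Suc (Suc k)))"
      \<comment> \<open>By exactness the cokernel of \<open>A (Suc k)\<close> embeds through
        \<open>A k\<close> into a free module, where the variable is regular.\<close>
      then have "app (b (Suc k)) (A k) (\<lambda>i. var (Suc n) * u i) = 0"
        using Suc.prems(1) by (auto simp: minimal_complex_def)
      then have "app (b (Suc k)) (A k) u = 0"
        by (simp add: app_scale fun_eq_iff)
      with u show "u \<in> app (b (Suc (Suc k))) (A (Suc k)) ` vecs (Suc n) (b (Suc (Suc k)))"
        using Suc.prems(2) by (auto simp: exact_complex_def)
    qed (use Suc.prems in \<open>auto simp: exact_complex_def minimal_complex_def irrelevant_ideal_def\<close>)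
  qed
  moreover obtain l where "k = Suc l" "n < l" using Suc.prems(3) by (cases k) auto
  ultimately show ?case using Suc.IH[of ?b ?A l] by simp
qed

text \<open>If the last variable is regular on the cokernel of \<open>A 0\<close>, no shift is needed in the
  first reduction, so the resolution is shorter by one.\<close>

lemma syzygy_regular:
  assumes min: "minimal_complex (Suc n) b A" and ex: "exact_complex (Suc n) b A"
    and regular: "\<And>u. u \<in> vecs (Suc n) (b 0) \<Longrightarrow>
       (\<lambda>i. var (Suc n) * u i) \<in> app (b 1) (A 0) ` vecs (Suc n) (b 1) \<Longrightarrow>
       u \<in> app (b 1) (A 0) ` vecs (Suc n) (b 1)"
    and k: "n < k"
  shows "b k = 0"
proof (rule syzygy[OF minimal_complex_reduce[OF min] _ k])
  let ?A = "\<lambda>k i j. reduce (Suc n) (A k i j)"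
  show "exact_complex n b ?A"
    unfolding exact_complex_def
  proof (intro allI ballI impI)
    fix k v
    assume v: "v \<in> vecs n (b (Suc k))" "app (b (Suc k)) (?A k) v = 0"
    show "v \<in> app (b (Suc (Suc k))) (?A (Suc k)) ` vecs n (b (Suc (Suc k)))"
    proof (rule exact_reduce[OF _ _ _ _ v])
      fix u :: "nat \<Rightarrow> 'a mpoly"
      assume u: "u \<in> vecs (Suc n) (b k)"
        and im: "(\<lambda>i. var (Suc n) * u i) \<in> app (b (Suc k)) (A k) ` vecs (Suc n) (b (Suc k))"
      show "u \<in> app (b (Suc k)) (A k) ` vecs (Suc n) (b (Suc k))"
      \<comment> \<open>Position 0 is the regularity hypothesis; in the others the cokernel embeds
        into a free module.\<close>
      proof (cases k)
        case 0
        with u im regular show ?thesis by simp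
      next
        case (Suc l)
        have "app (b (Suc l)) (A l) (\<lambda>i. var (Suc n) * u i) = 0"
          using min im Suc by (auto simp: minimal_complex_def)
        then have "app (b (Suc l)) (A l) u = 0"
          by (simp add: app_scale fun_eq_iff)
        with u show ?thesis
          using ex Suc by (auto simp: exact_complex_def)
      qed
    qed (use min ex in \<open>auto simp: exact_complex_def minimal_complex_def irrelevant_ideal_def\<close>)
  qed
qed

section \<open>Dimension counting\<close>

text \<open>The coordinates of \<open>z\<close> with respect to \<open>B\<close> are supported both
  in \<open>A\<close> and in \<open>C\<close>.\<close>

lemma (in vector_space) span_disjoint_basis_parts:
  assumes B: "independent B" and "A \<subseteq> B" "C \<subseteq> B" "A \<inter> C = {}" "z \<in> span A" "z \<in> span C"
  shows "z = 0"
proof -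
  have "representation B z = representation A z" "representation B z = representation C z"
    using assms by (auto intro: representation_extend)
  then have "representation A z b = 0" for b
    using representation_ne_zero[of A z b] representation_ne_zero[of C z b] \<open>A \<inter> C = {}\<close> by auto
  moreover have "independent A" using B \<open>A \<subseteq> B\<close> by (rule independent_mono)
  ultimately show ?thesis
    using sum_nonzero_representation_eq[of A z] \<open>z \<in> span A\<close> by simp
qed

text \<open>Rank-nullity relative to a finite-dimensional subspace \<open>V\<close>: a basis of the
  kernel is extended to a basis of \<open>V\<close>, and the added vectors have independent
  images.\<close>

lemma (in vector_space_pair) dim_kernel_image:
  assumes f: "Vector_Spaces.linear s1 s2 f" and V: "vs1.subspace V" and T: "finite T" "V \<subseteq> vs1.span T"
  shows "vs1.dim V = vs1.dim {v \<in> V. f v = 0} + vs2.dim (f ` V)"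
proof -
  interpret f: Vector_Spaces.linear s1 s2 f by (rule f)
  let ?K = "{v \<in> V. f v = 0}"
  obtain A where A: "A \<subseteq> ?K" "vs1.independent A" "?K \<subseteq> vs1.span A"
    by (rule vs1.maximal_independent_subset[of ?K])
  have "A \<subseteq> V" using A(1) by blast
  then obtain B where B: "A \<subseteq> B" "B \<subseteq> V" "vs1.independent B" "V \<subseteq> vs1.span B"
    using A(2) by (rule vs1.maximal_independent_subset_extend)
  have finB: "finite B"
    using vs1.independent_span_bound[OF T(1) B(3)] B(2) T(2) by blast
  let ?C = "B - A"
  have inj: "inj_on f (vs1.span ?C)"
  proof (rule inj_onI)
    fix x y assume xy: "x \<in> vs1.span ?C" "y \<in> vs1.span ?C" "f x = f y"
    have diff: "x - y \<in> vs1.span ?C" using xy by (intro vs1.span_diff)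
    moreover have "vs1.span ?C \<subseteq> V" using B(2) V by (intro vs1.span_minimal) auto
    ultimately have "x - y \<in> ?K" using xy(3) by (auto simp: f.diff)
    then have "x - y \<in> vs1.span A" using A(3) by blast
    with B diff have "x - y = 0"
      by (intro vs1.span_disjoint_basis_parts[of B A ?C]) auto
    then show "x = y" by simp
  qed
  have "vs2.dim (f ` V) = card (f ` ?C)"
  proof (rule vs2.dim_unique[OF _ _ _ refl])
    show "f ` ?C \<subseteq> f ` V" using B(2) by blast
    show "vs2.independent (f ` ?C)"
      using f vs1.independent_mono[OF B(3), of ?C] inj by (intro linear_independent_injective_image) auto
    have "f ` V \<subseteq> f ` vs1.span B" using B(4) by blast
    also have "\<dots> = vs2.span (f ` B)" using linear_span_image[OF f, of B] by simp
    also have "\<dots> \<subseteq> vs2.span (f ` ?C)"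
    proof (rule vs2.span_minimal)
      show "f ` B \<subseteq> vs2.span (f ` ?C)"
      proof
        fix y assume "y \<in> f ` B"
        then obtain b where "b \<in> B" "y = f b" by blast
        then show "y \<in> vs2.span (f ` ?C)"
          using A(1) vs2.span_zero by (cases "b \<in> A") (auto intro: vs2.span_base)
      qed
    qed simp
    finally show "f ` V \<subseteq> vs2.span (f ` ?C)" .
  qed
  moreover have "card (f ` ?C) = card ?C"
    using inj_on_subset[OF inj vs1.span_superset] by (rule card_image)
  moreover have "card B = card A + card ?C"
    using finB B(1) by (simp add: card_Diff_subset finite_subset card_mono)
  moreover have "vs1.dim V = card B" using B by (intro vs1.dim_unique) auto
  moreover have "vs1.dim ?K = card A" using A by (intro vs1.dim_unique) auto
  ultimately show ?thesis by simp
qed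

text \<open>Applied in a fixed degree: \<open>v k\<close> is the dimension of the k-th free module,
  \<open>z k\<close> that of its cycles, and \<open>h\<close> that of the semigroup algebra.\<close>

lemma alternating_sum_telescope:
  fixes v z :: "nat \<Rightarrow> int"
  assumes "v 0 = z 0 + h" and "\<And>k. v (Suc k) = z (Suc k) + z k"
  shows "(\<Sum>k\<le>N. (-1) ^ k * v k) = h + (-1) ^ N * z N"
  by (induction N) (simp_all add: assms algebra_simps)

section \<open>The Hilbert series of the polynomial ring\<close>

lemma wdeg_superset:
  "finite I \<Longrightarrow> keys a \<subseteq> I \<Longrightarrow> wdeg d a = (\<Sum>i\<in>I. lookup a i * d i)"
  unfolding wdeg_def by (rule sum.mono_neutral_left) (auto simp: in_keys_iff)

lemma wdeg_add: "wdeg d (a + b) = wdeg d a + wdeg d b"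
proof -
  let ?I = "keys a \<union> keys b"
  have "wdeg d (a + b) = (\<Sum>i\<in>?I. lookup (a + b) i * d i)"
    by (rule wdeg_superset) (simp_all add: keys_add_nat)
  also have "\<dots> = (\<Sum>i\<in>?I. lookup a i * d i) + (\<Sum>i\<in>?I. lookup b i * d i)"
    by (simp add: lookup_add distrib_right sum.distrib)
  also have "\<dots> = wdeg d a + wdeg d b"
    by (simp add: wdeg_superset[of ?I])
  finally show ?thesis .
qed

lemma wdeg_single: "wdeg d (Poly_Mapping.single i c) = c * d i"
  by (simp add: wdeg_def)

definition monomials :: "(nat \<Rightarrow> nat) \<Rightarrow> nat \<Rightarrow> nat \<Rightarrow> (nat \<Rightarrow>\<^sub>0 nat) set" where
  "monomials d m t = {a. keys a \<subseteq> {1..m} \<and> wdeg d a = t}"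

lemma monomials_0: "monomials d 0 t = (if t = 0 then {0} else {})"
  by (auto simp: monomials_def wdeg_def)

text \<open>Case split on whether the last variable occurs; if it does, it is divided out
  once.\<close>

lemma monomials_Suc:
  "monomials d (Suc m) t = monomials d m t \<union>
     (if d (Suc m) \<le> t
      then (\<lambda>a. a + Poly_Mapping.single (Suc m) 1) ` monomials d (Suc m) (t - d (Suc m)) else {})"
  (is "?L = ?R")
proof
  show "?L \<subseteq> ?R"
  proof
    fix a assume a: "a \<in> ?L"
    show "a \<in> ?R"
    proof (cases "Suc m \<in> keys a")
      case True
      define b where "b = a - Poly_Mapping.single (Suc m) 1"
      have ab: "a = b + Poly_Mapping.single (Suc m) 1"
        using True unfolding b_def
        by (intro poly_mapping_eqI) (auto simp: lookup_add lookup_minus lookup_single when_def in_keys_iff)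
      with a have "wdeg d b + d (Suc m) = t" "keys b \<subseteq> {1..Suc m}"
        by (auto simp: monomials_def wdeg_add wdeg_single keys_add_nat)
      then have "d (Suc m) \<le> t" "b \<in> monomials d (Suc m) (t - d (Suc m))"
        by (auto simp: monomials_def)
      with ab show ?thesis by auto
    next
      case False
      have "keys a \<subseteq> {1..m}"
      proof
        fix i assume i: "i \<in> keys a"
        with a have "i \<in> {1..Suc m}" by (auto simp: monomials_def)
        moreover have "i \<noteq> Suc m" using i False by auto
        ultimately show "i \<in> {1..m}" by auto
      qed
      with a show ?thesis by (auto simp: monomials_def)
    qed
  qed
  show "?R \<subseteq> ?L"
  proof
    fix a assume "a \<in> ?R"
    then consider "a \<in> monomials d m t" | b where "d (Suc m) \<le> t"
        "b \<in> monomials d (Suc m) (t - d (Suc m))" "a = b + Poly_Mapping.single (Suc m) 1"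
      by (auto split: if_splits)
    then show "a \<in> ?L"
      by cases (fastforce simp: monomials_def keys_add_nat wdeg_add wdeg_single)+
  qed
qed

lemma finite_monomials:
  assumes "\<And>i. i \<in> {1..m} \<Longrightarrow> 0 < d i"
  shows "finite (monomials d m t)"
  using assms
proof (induction m arbitrary: t)
  case 0
  show ?case by (simp add: monomials_0)
next
  case (Suc m)
  have "0 < d (Suc m)" using Suc.prems by simp
  show ?case
  \<comment> \<open>The degree of the last variable is positive, so dividing by it lowers
    \<open>t\<close>.\<close>
  proof (induction t rule: less_induct)
    case (less t)
    have "finite (monomials d m t)" using Suc.prems by (intro Suc.IH) auto
    then show ?case
      unfolding monomials_Suc[of d m t] using less[of "t - d (Suc m)"] \<open>0 < d (Suc m)\<close> by auto
  qed
qed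

text \<open>The Hilbert series of the polynomial ring.\<close>

definition monomial_series :: "(nat \<Rightarrow> nat) \<Rightarrow> nat \<Rightarrow> 'a::comm_ring_1 fps" where
  "monomial_series d m = Abs_fps (\<lambda>t. of_nat (card (monomials d m t)))"

lemma monomial_series_Suc:
  assumes "\<And>i. i \<in> {1..Suc m} \<Longrightarrow> 0 < d i"
  shows "(1 - fps_X ^ d (Suc m)) * monomial_series d (Suc m) = monomial_series d m"
proof (rule fps_ext)
  fix t
  have fin: "finite (monomials d (Suc m) t)" for t
    using assms by (rule finite_monomials)
  have "card (monomials d (Suc m) t) = card (monomials d m t) +
      (if d (Suc m) \<le> t then card (monomials d (Suc m) (t - d (Suc m))) else 0)"
  proof (cases "d (Suc m) \<le> t")
    case True
    let ?I = "(\<lambda>a. a + Poly_Mapping.single (Suc m) 1) ` monomials d (Suc m) (t - d (Suc m))"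
    have "monomials d m t \<inter> ?I = {}"
      by (auto simp: monomials_def keys_add_nat)
    moreover have "finite (monomials d m t)" using assms by (intro finite_monomials) auto
    moreover have "monomials d (Suc m) t = monomials d m t \<union> ?I"
      using True by (subst monomials_Suc) simp
    moreover have "card ?I = card (monomials d (Suc m) (t - d (Suc m)))"
      by (rule card_image) (auto intro: inj_onI)
    ultimately show ?thesis using True fin by (simp add: card_Un_disjoint)
  next
    case False
    then show ?thesis by (subst monomials_Suc) simp
  qed
  then show "fps_nth ((1 - fps_X ^ d (Suc m)) * monomial_series d (Suc m)) t = fps_nth (monomial_series d m) t"
    by (simp add: monomial_series_def left_diff_distrib fps_X_power_mult_nth not_le)
qed

text \<open>Each variable contributes a geometric series. The product form avoids inverting power
  series.\<close>

lemma prod_monomial_series: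
  assumes "\<And>i. i \<in> {1..m} \<Longrightarrow> 0 < d i"
  shows "(\<Prod>i=1..m. 1 - fps_X ^ d i) * monomial_series d m = 1"
  using assms
proof (induction m)
  case 0
  show ?case by (rule fps_ext) (simp add: monomial_series_def monomials_0)
next
  case (Suc m)
  have "(\<Prod>i=1..Suc m. 1 - fps_X ^ d i) * monomial_series d (Suc m) =
      (\<Prod>i=1..m. 1 - fps_X ^ d i) * ((1 - fps_X ^ d (Suc m)) * monomial_series d (Suc m) :: 'a fps)"
    by (simp add: mult.assoc)
  also have "\<dots> = (\<Prod>i=1..m. 1 - fps_X ^ d i) * monomial_series d m"
    using Suc.prems by (subst monomial_series_Suc) auto
  also have "\<dots> = 1" using Suc.prems by (intro Suc.IH) auto
  finally show ?case .
qed

section \<open>The Hilbert series of the semigroup algebra\<close>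

text \<open>The Hilbert series of the semigroup algebra: its part of degree \<open>s\<close> has
  dimension one or zero.\<close>

definition indicator_series :: "nat set \<Rightarrow> 'a::comm_ring_1 fps" where
  "indicator_series S = Abs_fps (\<lambda>s. if s \<in> S then 1 else 0)"

text \<open>The coefficients of the polynomial are supported on the Apery set of \<open>c\<close>, which has at
  most one element in each residue class modulo \<open>c\<close>.\<close>

lemma indicator_series_polynomial:
  assumes "0 < c" and S: "\<And>s. s \<in> S \<Longrightarrow> s + c \<in> S"
  obtains A where "(1 - fps_X ^ c) * indicator_series S = fps_of_poly A"
proof
  \<comment> \<open>The guard matters: for \<open>s < c\<close> truncated subtraction would give 0,
    which a semigroup contains.\<close>
  let ?T = "{s \<in> S. c \<le> s \<longrightarrow> s - c \<notin> S}"
  have S': "s + j * c \<in> S" if "s \<in> S" for s j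
    using that by (induction j) (auto dest: S simp: ac_simps)
  have "inj_on (\<lambda>s. s mod c) ?T"
  proof (rule linorder_inj_onI)
    fix x y assume xy: "x < y" "x \<in> ?T" "y \<in> ?T"
    show "x mod c \<noteq> y mod c"
    proof
      assume "x mod c = y mod c"
      then have "c dvd y - x" using xy(1) by (metis mod_eq_dvd_iff_nat less_imp_le)
      then obtain j where j: "y - x = c * j" by blast
      with xy(1) obtain l where "j = Suc l" by (cases j) auto
      \<comment> \<open>\<open>y - c\<close> is reached from \<open>x\<close> by steps of
        \<open>c\<close>, hence lies in \<open>S\<close>, which contradicts membership of
        \<open>y\<close> in \<open>?T\<close>.\<close>
      with j xy(1) have "y = (x + l * c) + c" by (simp add: algebra_simps)
      moreover have "x + l * c \<in> S" using xy(2) by (intro S') auto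
      ultimately show False using xy(3) by auto
    qed
  qed auto
  moreover have "(\<lambda>s. s mod c) ` ?T \<subseteq> {..<c}" using \<open>0 < c\<close> by auto
  ultimately have "finite ?T" by (rule inj_on_finite) simp
  then have coeff: "poly.coeff (\<Sum>s\<in>?T. Polynomial.monom 1 s) n = (if n \<in> ?T then 1 else 0 :: 'a)" for n
    by (simp add: coeff_sum)
  show "(1 - fps_X ^ c) * indicator_series S = fps_of_poly (\<Sum>s\<in>?T. Polynomial.monom 1 s :: 'a poly)"
  proof (rule fps_ext)
    fix n
    \<comment> \<open>Closure under adding \<open>c\<close> excludes the coefficient -1.\<close>
    have "n \<in> S" if "c \<le> n" "n - c \<in> S" using S[OF that(2)] that(1) by simp
    then show "fps_nth ((1 - fps_X ^ c) * indicator_series S) n =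
        fps_nth (fps_of_poly (\<Sum>s\<in>?T. Polynomial.monom 1 s :: 'a poly)) n"
      by (auto simp: coeff indicator_series_def left_diff_distrib fps_X_power_mult_nth)
  qed
qed

section \<open>Multiple roots and weighted coefficient sums\<close>

text \<open>The Euler operator \<open>z d/dz\<close>. Monomials are its eigenvectors, so iterating
  it produces plain powers of the exponents instead of falling factorials.\<close>

definition theta :: "'a::idom poly \<Rightarrow> 'a poly" where
  "theta p = pCons 0 (pderiv p)"

lemma theta_add: "theta (p + q) = theta p + theta q"
  by (simp add: theta_def pderiv_add)

lemma theta_monom: "theta (Polynomial.monom c n) = Polynomial.monom (c * of_nat n) n"
  by (rule poly_eqI) (simp add: theta_def coeff_pCons coeff_pderiv ac_simps split: nat.split)

lemma funpow_theta_sum: "(theta ^^ r) (\<Sum>x\<in>I. f x) = (\<Sum>x\<in>I. (theta ^^ r) (f x))"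
proof -
  have zero: "(theta ^^ r) 0 = 0" by (induction r) (simp_all add: theta_def)
  have add: "(theta ^^ r) (p + q) = (theta ^^ r) p + (theta ^^ r) q" for p q
    by (induction r) (simp_all add: theta_add)
  show ?thesis
    by (induction I rule: infinite_finite_induct) (simp_all add: zero add)
qed

lemma funpow_theta_monom:
  "(theta ^^ r) (Polynomial.monom c n) = Polynomial.monom (c * of_nat n ^ r) n"
  by (induction r) (simp_all add: theta_monom ac_simps)

text \<open>Differentiation lowers the multiplicity of a root by at most one.\<close>

lemma theta_dvd:
  assumes "[:- z, 1:] ^ Suc k dvd p"
  shows "[:- z, 1:] ^ k dvd theta p"
proof -
  obtain u where p: "p = [:- z, 1:] ^ Suc k * u" using assms by (rule dvdE)
  have "pderiv p = [:- z, 1:] ^ k * ([:- z, 1:] * pderiv u + Polynomial.smult (of_nat (Suc k)) u)"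
    unfolding p pderiv_mult pderiv_power_Suc by (simp add: pderiv_pCons algebra_simps)
  then have "[:- z, 1:] ^ k dvd pderiv p" by (metis dvd_triv_left)
  then have "[:- z, 1:] ^ k dvd [:0, 1:] * pderiv p" by (rule dvd_mult)
  then show ?thesis by (simp add: theta_def)
qed

text \<open>After \<open>r\<close> applications of \<open>theta\<close> a factor vanishing at
  \<open>z\<close> is still left. Exponents may repeat within the family.\<close>

lemma weighted_sum_eq_0:
  fixes z :: "'a::idom"
  assumes "[:- z, 1:] ^ Suc r dvd (\<Sum>x\<in>I. Polynomial.monom (c x) (n x))"
  shows "(\<Sum>x\<in>I. c x * of_nat (n x) ^ r * z ^ n x) = 0"
proof -
  \<comment> \<open>Stated for every \<open>k\<close>, because the induction on \<open>l\<close>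
    raises the exponent.\<close>
  have *: "[:- z, 1:] ^ k dvd (theta ^^ l) p" if "[:- z, 1:] ^ (k + l) dvd p" for k l and p :: "'a poly"
    using that
  proof (induction l arbitrary: k)
    case (Suc l)
    then have "[:- z, 1:] ^ Suc k dvd (theta ^^ l) p" by (intro Suc.IH) simp
    from theta_dvd[OF this] show ?case by simp
  qed simp
  from *[of 1 r] assms have "poly ((theta ^^ r) (\<Sum>x\<in>I. Polynomial.monom (c x) (n x))) z = 0"
    by (simp add: poly_eq_0_iff_dvd)
  then show ?thesis
    by (simp add: funpow_theta_sum funpow_theta_monom poly_sum poly_monom)
qed

text \<open>Each factor whose exponent is a multiple of \<open>q\<close> has \<open>z\<close> as a
  root and supplies one linear factor.\<close>

lemma power_dvd_prod_one_minus_monom: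
  fixes z :: "'a::idom"
  assumes "z ^ q = 1" and "finite J"
  shows "[:- z, 1:] ^ card {j \<in> J. q dvd d j} dvd (\<Prod>j\<in>J. 1 - Polynomial.monom 1 (d j))"
proof -
  let ?J = "{j \<in> J. q dvd d j}"
  have "[:- z, 1:] dvd 1 - Polynomial.monom 1 (d j)" if "q dvd d j" for j
    using that assms(1) by (auto simp: poly_eq_0_iff_dvd[symmetric] poly_monom power_mult elim!: dvdE)
  then have "(\<Prod>j\<in>?J. [:- z, 1:]) dvd (\<Prod>j\<in>?J. 1 - Polynomial.monom 1 (d j))"
    by (intro prod_dvd_prod) auto
  also have "\<dots> dvd (\<Prod>j\<in>J. 1 - Polynomial.monom 1 (d j))"
    using assms(2) by (intro prod_dvd_prod_subset) auto
  finally show ?thesis by simp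
qed

section \<open>Resolutions in terms of functions\<close>

lemma subst_add: "subst d (p + q) = subst d p + subst d q"
  unfolding subst_def
  by (rule setsum_keys_plus_distrib) (simp_all add: add_monom)

lemma subst_zero [simp]: "subst d 0 = 0"
  by (simp add: subst_def)

lemma subst_sum: "subst d (sum f I) = (\<Sum>i\<in>I. subst d (f i))"
  by (induction I rule: infinite_finite_induct) (simp_all add: subst_add)

lemma subst_single: "subst d (Poly_Mapping.single a c) = Polynomial.monom c (wdeg d a)"
  by (simp add: subst_def)

text \<open>A one-term multiplier covers both uses: variables and constants.\<close>

lemma subst_single_mult:
  "subst d (Poly_Mapping.single b c * p) = Polynomial.monom c (wdeg d b) * subst d p"
proof -
  have "subst d (Poly_Mapping.single b c * p) =
      subst d (\<Sum>a\<in>keys p. Poly_Mapping.single b c * Poly_Mapping.single a (lookup p a))"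
    by (subst (1) sum_single_keys[of p, symmetric]) (simp add: sum_distrib_left)
  also have "\<dots> = Polynomial.monom c (wdeg d b) * subst d p"
    by (simp add: subst_sum mult_single subst_single wdeg_add mult_monom[symmetric] sum_distrib_left
        subst_def[of d p])
  finally show ?thesis .
qed

lemma subst_var_mult: "subst d (var n * p) = Polynomial.monom 1 (d n) * subst d p"
  by (simp add: var_def subst_single_mult wdeg_single)

lemma coeff_subst: "poly.coeff (subst d p) s = (\<Sum>a | a \<in> keys p \<and> wdeg d a = s. lookup p a)"
  unfolding subst_def coeff_sum
  by (rule sum.mono_neutral_cong_right) auto

text \<open>Together with \<open>vec_inject_vecs\<close> this makes \<open>vec b\<close> a
  bijection, along which kernels and images are transferred.\<close>

lemma vec_image_vecs: "vec b ` vecs n b = free_module n b"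
proof
  show "vec b ` vecs n b \<subseteq> free_module n b"
    by (auto simp: vecs_def free_module_def)
  show "free_module n b \<subseteq> vec b ` vecs n b"
  proof
    fix v assume v: "v \<in> free_module n b"
    then have "v = vec b (\<lambda>i. if i < b then v $ i else 0)"
      by (intro eq_vecI) (auto simp: free_module_def)
    moreover have "(\<lambda>i. if i < b then v $ i else 0) \<in> vecs n b"
      using v by (auto simp: vecs_def free_module_def)
    ultimately show "v \<in> vec b ` vecs n b" by blast
  qed
qed

lemma vec_inject_vecs:
  assumes "u \<in> vecs n b" "v \<in> vecs n b" "vec b u = vec b v"
  shows "u = v"
proof
  fix i
  show "u i = v i"
  proof (cases "i < b")
    case True
    then show ?thesis using arg_cong[OF assms(3), of "\<lambda>x. x $ i"] by simp
  next
    case False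
    then show ?thesis using assms(1,2) by (simp add: vecs_def)
  qed
qed

text \<open>Entries outside the matrix are zero, so that \<open>app\<close> yields vectors extended
  by zero.\<close>

definition mat_fun :: "'a::zero mat \<Rightarrow> nat \<Rightarrow> nat \<Rightarrow> 'a" where
  "mat_fun A i j = (if i < dim_row A \<and> j < dim_col A then A $$ (i, j) else 0)"

lemma mult_mat_vec_eq_app:
  "A \<in> carrier_mat b' b \<Longrightarrow> A *\<^sub>v vec b u = vec b' (app b (mat_fun A) u)"
  by (intro eq_vecI) (auto simp: app_def scalar_prod_def mat_fun_def atLeast0LessThan intro!: sum.cong)

lemma app_vec_zero_iff:
  assumes "\<And>i j. b' \<le> i \<Longrightarrow> A i j = 0"
  shows "vec b' (app b A u) = 0\<^sub>v b' \<longleftrightarrow> app b A u = 0"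
proof
  assume *: "vec b' (app b A u) = 0\<^sub>v b'"
  show "app b A u = 0"
  proof
    fix i
    show "app b A u i = 0 i"
      using arg_cong[OF *, of "\<lambda>x. x $ i"] assms by (cases "i < b'") (simp_all add: app_def)
  qed
qed auto

text \<open>A graded free resolution in function form. Minimality is not included; it enters only in
  \<open>length_le\<close>.\<close>

locale resolution =
  fixes d :: "nat \<Rightarrow> nat" and m :: nat and S :: "nat set" and e :: "nat \<Rightarrow> nat list"
    and A :: "nat \<Rightarrow> nat \<Rightarrow> nat \<Rightarrow> 'k::field mpoly" and g :: "'k poly list"
  assumes d_pos: "i \<in> {1..m} \<Longrightarrow> 0 < d i"
    and A_ring: "A k i j \<in> poly_ring m"
    and A_zero: "length (e k) \<le> i \<Longrightarrow> A k i j = 0"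
    and A_deg: "i < length (e k) \<Longrightarrow> j < length (e (Suc k)) \<Longrightarrow> a \<in> keys (A k i j) \<Longrightarrow>
      e k ! i + wdeg d a = e (Suc k) ! j"
    and g_deg: "i < length (e 0) \<Longrightarrow> poly.coeff (g ! i) s \<noteq> 0 \<Longrightarrow> s = e 0 ! i"
    and aug_image: "(\<lambda>v. \<Sum>i<length (e 0). subst d (v i) * g ! i) ` vecs m (length (e 0)) =
      semigroup_algebra S"
    and aug_kernel: "{v \<in> vecs m (length (e 0)). (\<Sum>i<length (e 0). subst d (v i) * g ! i) = 0} =
      app (length (e 1)) (A 0) ` vecs m (length (e 1))"
    and exact: "{v \<in> vecs m (length (e (Suc k))). app (length (e (Suc k))) (A k) v = 0} =
      app (length (e (Suc (Suc k)))) (A (Suc k)) ` vecs m (length (e (Suc (Suc k))))"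

lemma graded_free_resolution_imp_resolution:
  assumes "\<And>i. i \<in> {1..m} \<Longrightarrow> 0 < d i" and "graded_free_resolution d m S e D g"
  shows "resolution d m S e (\<lambda>k. mat_fun (D k)) g"
proof -
  have G: "D k \<in> carrier_mat (length (e k)) (length (e (Suc k)))"
    "\<And>i j. i < length (e k) \<Longrightarrow> j < length (e (Suc k)) \<Longrightarrow> D k $$ (i, j) \<in> poly_ring m"
    "\<And>i j a. i < length (e k) \<Longrightarrow> j < length (e (Suc k)) \<Longrightarrow> a \<in> keys (D k $$ (i, j)) \<Longrightarrow>
      e k ! i + wdeg d a = e (Suc k) ! j" for k
    using assms(2) by (auto simp: graded_free_resolution_def graded_matrix_def)
  have dims: "dim_row (D k) = length (e k)" "dim_col (D k) = length (e (Suc k))" for k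
    using G(1)[of k] by auto
  have len: "length g = length (e 0)"
    using assms(2) by (simp add: graded_free_resolution_def)
  let ?b = "\<lambda>k. length (e k)"
  let ?aug = "\<lambda>v. \<Sum>i<?b 0. subst d (v i) * g ! i"
  have aug: "augmentation d g (vec (?b 0) v) = ?aug v" for v
    by (simp add: augmentation_def len)
  have ring: "mat_fun (D k) i j \<in> poly_ring m" for k i j
    by (auto simp: mat_fun_def dims G(2))
  have zero: "?b k \<le> i \<Longrightarrow> mat_fun (D k) i j = 0" for k i j
    by (auto simp: mat_fun_def dims)
  have app_vecs: "v \<in> vecs m (?b (Suc k)) \<Longrightarrow> app (?b (Suc k)) (mat_fun (D k)) v \<in> vecs m (?b k)" for k v
    using ring zero by (rule app_in_vecs)
  have im: "(\<lambda>u. D k *\<^sub>v u) ` free_module m (?b (Suc k)) =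
      vec (?b k) ` app (?b (Suc k)) (mat_fun (D k)) ` vecs m (?b (Suc k))" for k
    unfolding vec_image_vecs[symmetric] image_image
    by (simp add: mult_mat_vec_eq_app[OF G(1)])
  \<comment> \<open>Injectivity of \<open>vec\<close> on \<open>vecs\<close> turns equality of
    images into equality of the sets themselves.\<close>
  have transfer: "X = app (?b (Suc k)) (mat_fun (D k)) ` vecs m (?b (Suc k))"
    if "vec (?b k) ` X = (\<lambda>u. D k *\<^sub>v u) ` free_module m (?b (Suc k))" and "X \<subseteq> vecs m (?b k)"
    for k X
  proof -
    have "inj_on (vec (?b k)) (vecs m (?b k))"
      by (auto intro: inj_onI vec_inject_vecs)
    then show ?thesis
      using that app_vecs unfolding im by (subst (asm) inj_on_image_eq_iff) auto
  qed
  show ?thesis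
  proof
    show "?aug ` vecs m (?b 0) = semigroup_algebra S"
      using assms(2) unfolding graded_free_resolution_def vec_image_vecs[symmetric] image_image aug by blast
    have "{v \<in> free_module m (?b 0). augmentation d g v = 0} =
        (\<lambda>u. D 0 *\<^sub>v u) ` free_module m (?b (Suc 0))"
      using assms(2) by (simp add: graded_free_resolution_def)
    moreover have "{v \<in> free_module m (?b 0). augmentation d g v = 0} =
        vec (?b 0) ` {v \<in> vecs m (?b 0). ?aug v = 0}"
      unfolding vec_image_vecs[symmetric] by (auto simp: aug)
    ultimately show "{v \<in> vecs m (?b 0). ?aug v = 0} = app (?b 1) (mat_fun (D 0)) ` vecs m (?b 1)"
      using transfer[of 0 "{v \<in> vecs m (?b 0). ?aug v = 0}"] by auto
  next
    fix k
    let ?X = "{v \<in> vecs m (?b (Suc k)). app (?b (Suc k)) (mat_fun (D k)) v = 0}"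
    have "{v \<in> free_module m (?b (Suc k)). D k *\<^sub>v v = 0\<^sub>v (?b k)} = vec (?b (Suc k)) ` ?X"
      unfolding vec_image_vecs[symmetric]
      by (auto simp: mult_mat_vec_eq_app[OF G(1)] app_vec_zero_iff[OF zero])
    moreover have "{v \<in> free_module m (?b (Suc k)). D k *\<^sub>v v = 0\<^sub>v (?b k)} =
        (\<lambda>u. D (Suc k) *\<^sub>v u) ` free_module m (?b (Suc (Suc k)))"
      using assms(2) by (simp add: graded_free_resolution_def)
    ultimately show "?X = app (?b (Suc (Suc k))) (mat_fun (D (Suc k))) ` vecs m (?b (Suc (Suc k)))"
      by (intro transfer) auto
  next
    fix k i j a assume "i < ?b k" "j < ?b (Suc k)" "a \<in> keys (mat_fun (D k) i j)"
    then show "e k ! i + wdeg d a = e (Suc k) ! j"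
      by (intro G(3)) (simp_all add: mat_fun_def dims)
  next
    fix i s assume "i < ?b 0" "poly.coeff (g ! i) s \<noteq> 0"
    then show "s = e 0 ! i"
      using assms(2) len by (auto simp: graded_free_resolution_def)
  qed (use assms(1) ring zero in auto)
qed

context resolution
begin

abbreviation "b k \<equiv> length (e k)"

definition aug :: "(nat \<Rightarrow> 'k mpoly) \<Rightarrow> 'k poly" where
  "aug v = (\<Sum>i<b 0. subst d (v i) * g ! i)"

lemma aug_var: "aug (\<lambda>i. var n * u i) = Polynomial.monom 1 (d n) * aug u"
  by (simp add: aug_def subst_var_mult sum_distrib_left mult.assoc)

text \<open>The cokernel of \<open>A 0\<close> is the semigroup algebra, where a variable acts as a
  nonzero monomial in \<open>t\<close> and hence is regular. So \<open>syzygy_regular\<close>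
  applies.\<close>

lemma length_le:
  assumes minimal: "\<And>k i j. A k i j \<in> irrelevant_ideal m" and m: "m = Suc n" and k: "n < k"
  shows "e k = []"
proof -
  have "minimal_complex (Suc n) b A"
    unfolding minimal_complex_def
  proof (intro conjI allI ballI impI)
    fix k and v :: "nat \<Rightarrow> 'k mpoly" assume "v \<in> vecs (Suc n) (b (Suc (Suc k)))"
    then have "app (b (Suc (Suc k))) (A (Suc k)) v \<in>
        {v \<in> vecs m (length (e (Suc k))). app (length (e (Suc k))) (A k) v = 0}"
      unfolding exact unfolding m by (rule imageI)
    then show "app (b (Suc k)) (A k) (app (b (Suc (Suc k))) (A (Suc k)) v) = 0" by simp
  qed (use minimal A_zero m in auto)
  moreover have "exact_complex (Suc n) b A"
    using exact unfolding exact_complex_def m by blast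
  moreover have "u \<in> app (b 1) (A 0) ` vecs (Suc n) (b 1)"
    if u: "u \<in> vecs (Suc n) (b 0)" and im: "(\<lambda>i. var (Suc n) * u i) \<in> app (b 1) (A 0) ` vecs (Suc n) (b 1)" for u
  proof -
    have "aug (\<lambda>i. var (Suc n) * u i) = 0"
      using im unfolding aug_kernel[symmetric, unfolded m] by (simp add: aug_def)
    then have "aug u = 0" by (simp add: aug_var)
    then show ?thesis
      using u unfolding aug_kernel[symmetric, unfolded m] by (simp add: aug_def)
  qed
  ultimately have "b k = 0"
    using k by (rule syzygy_regular)
  then show ?thesis by simp
qed

end

section \<open>Graded pieces of a resolution\<close>

text \<open>Scalars act as constant polynomials, which makes the whole function type a vector space
  with the graded pieces as subspaces.\<close>

definition scale_vec :: "'k::field \<Rightarrow> (nat \<Rightarrow> 'k mpoly) \<Rightarrow> nat \<Rightarrow> 'k mpoly" where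
  "scale_vec c v = (\<lambda>i. Poly_Mapping.single 0 c * v i)"



lemma lookup_single_0_mult:
  fixes p :: "'a::monoid_add \<Rightarrow>\<^sub>0 'b::semiring_0"
  shows "lookup (Poly_Mapping.single 0 c * p) a = c * lookup p a"
  unfolding mult_map_scale_conv_mult[symmetric] by (simp add: map.rep_eq when_def)

lemma keys_single_0_mult: "keys (Poly_Mapping.single 0 c * p) \<subseteq> keys p"
  by (auto simp: in_keys_iff lookup_single_0_mult)

interpretation vecs: vector_space "scale_vec :: 'k::field \<Rightarrow> _"
  by unfold_locales
    (simp_all add: scale_vec_def fun_eq_iff distrib_left single_add distrib_right mult_single
      mult.assoc[symmetric])

text \<open>The second space is the field over itself, the target of the functional that reads off a
  coefficient.\<close>

interpretation vecs_field: vector_space_pair "scale_vec :: 'k::field \<Rightarrow> _" "(*) :: 'k \<Rightarrow> 'k \<Rightarrow> 'k"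
  by unfold_locales (simp_all add: algebra_simps)

interpretation vecs_pair: vector_space_pair "scale_vec :: 'k::field \<Rightarrow> _" "scale_vec :: 'k::field \<Rightarrow> _"
  ..

lemma sum_fun_apply: "(sum f I) x = (\<Sum>i\<in>I. f i x)"
  by (induction I rule: infinite_finite_induct) simp_all

definition unit_monomial :: "nat \<times> (nat \<Rightarrow>\<^sub>0 nat) \<Rightarrow> nat \<Rightarrow> 'k::field mpoly" where
  "unit_monomial x = (\<lambda>i. if i = fst x then Poly_Mapping.single (snd x) 1 else 0)"

text \<open>Reading off coordinates gives both independence and spanning of the monomial
  basis.\<close>

lemma lookup_sum_unit_monomial:
  assumes "finite I"
  shows "lookup ((\<Sum>x\<in>I. scale_vec (h x) (unit_monomial x)) i) a = (if (i, a) \<in> I then h (i, a) else 0)"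
proof -
  have "lookup ((\<Sum>x\<in>I. scale_vec (h x) (unit_monomial x)) i) a = (\<Sum>x\<in>I. if x = (i, a) then h x else 0)"
    unfolding sum_fun_apply lookup_sum
    by (intro sum.cong) (auto simp: scale_vec_def unit_monomial_def mult_single lookup_single when_def)
  then show ?thesis using assms by simp
qed

lemma inj_unit_monomial: "inj (unit_monomial :: _ \<Rightarrow> nat \<Rightarrow> 'k::field mpoly)"
proof (rule injI)
  fix x y assume eq: "(unit_monomial x :: nat \<Rightarrow> 'k mpoly) = unit_monomial y"
  have "lookup (unit_monomial x (fst x) :: 'k mpoly) (snd x) = 1"
    by (simp add: unit_monomial_def)
  then have "lookup (unit_monomial y (fst x) :: 'k mpoly) (snd x) = 1"
    by (simp add: eq)
  then show "x = y"
    by (auto simp: unit_monomial_def lookup_single when_def prod_eq_iff split: if_splits)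
qed

lemma independent_unit_monomials:
  assumes "finite I"
  shows "vecs.independent (unit_monomial ` I :: (nat \<Rightarrow> 'k::field mpoly) set)"
proof (rule vecs.independent_if_scalars_zero)
  fix f :: "(nat \<Rightarrow> 'k mpoly) \<Rightarrow> 'k" and v :: "nat \<Rightarrow> 'k mpoly"
  assume sum: "(\<Sum>x\<in>unit_monomial ` I. scale_vec (f x) x) = 0" and "v \<in> unit_monomial ` I"
  then obtain x where x: "x \<in> I" "v = unit_monomial x" by blast
  have "(\<Sum>x\<in>I. scale_vec (f (unit_monomial x)) (unit_monomial x)) = 0"
    using sum inj_on_subset[OF inj_unit_monomial, of I]
    by (subst (asm) sum.reindex) (auto simp: o_def)
  then have "f (unit_monomial x) = 0"
    using lookup_sum_unit_monomial[OF assms, of "\<lambda>x. f (unit_monomial x)" "fst x" "snd x"] x(1) by simp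
  with x show "f v = 0" by simp
qed (use assms in simp)

context resolution
begin

definition piece :: "nat \<Rightarrow> nat \<Rightarrow> (nat \<Rightarrow> 'k mpoly) set" where
  "piece k s = {v \<in> vecs m (b k). \<forall>i<b k. \<forall>a\<in>keys (v i). e k ! i + wdeg d a = s}"

definition basis_index :: "nat \<Rightarrow> nat \<Rightarrow> (nat \<times> (nat \<Rightarrow>\<^sub>0 nat)) set" where
  "basis_index k s = (SIGMA i:{..<b k}. {a. keys a \<subseteq> {1..m} \<and> e k ! i + wdeg d a = s})"

lemma homogeneous_monomials:
  "{a. keys a \<subseteq> {1..m} \<and> l + wdeg d a = s} = (if l \<le> s then monomials d m (s - l) else {})"
  by (auto simp: monomials_def)

lemma subspace_piece: "vecs.subspace (piece k s)"
proof (rule vecs.subspaceI)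
  show "0 \<in> piece k s" by (simp add: piece_def vecs_def)
next
  fix u v assume "u \<in> piece k s" "v \<in> piece k s"
  then show "u + v \<in> piece k s"
    using keys_add by (fastforce simp: piece_def vecs_def poly_ring_add)
next
  fix c v assume v: "v \<in> piece k s"
  have keys: "keys (scale_vec c v i) \<subseteq> keys (v i)" for i
    unfolding scale_vec_def by (rule keys_single_0_mult)
  have "scale_vec c v i \<in> poly_ring m" for i
    using v keys[of i] by (auto simp: piece_def vecs_def poly_ring_def)
  moreover have "scale_vec c v i = 0" if "b k \<le> i" for i
    using v that by (simp add: piece_def vecs_def scale_vec_def)
  ultimately show "scale_vec c v \<in> piece k s"
    using v keys by (fastforce simp: piece_def vecs_def)
qed

definition component :: "nat \<Rightarrow> nat \<Rightarrow> (nat \<Rightarrow> 'k mpoly) \<Rightarrow> nat \<Rightarrow> 'k mpoly" where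
  "component k s v = (\<lambda>i. restr (\<lambda>a. e k ! i + wdeg d a = s) (v i))"

lemma component_in_piece: "v \<in> vecs m (b k) \<Longrightarrow> component k s v \<in> piece k s"
  by (auto simp: piece_def component_def vecs_def poly_ring_restr keys_restr)

lemma component_piece: "v \<in> piece k s \<Longrightarrow> component k s v = v"
proof
  fix i assume v: "v \<in> piece k s"
  show "component k s v i = v i"
    using v by (cases "i < b k") (auto simp: component_def piece_def vecs_def intro: restr_eq_self)
qed

text \<open>The entries of \<open>A k\<close> are homogeneous of the degrees that make the map
  degree-preserving.\<close>

lemma component_app: "component k s (app (b (Suc k)) (A k) v) = app (b (Suc k)) (A k) (component (Suc k) s v)"
proof
  fix i
  show "component k s (app (b (Suc k)) (A k) v) i = app (b (Suc k)) (A k) (component (Suc k) s v) i"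
  proof (cases "i < b k")
    case True
    show ?thesis
      unfolding component_def app_def restr_sum
      by (intro sum.cong refl restr_mult)
        (auto simp: wdeg_add add.assoc[symmetric] A_deg[OF True])
  qed (simp add: component_def app_def A_zero)
qed

lemma app_in_vecs_length: "v \<in> vecs m (b (Suc k)) \<Longrightarrow> app (b (Suc k)) (A k) v \<in> vecs m (b k)"
  using A_ring A_zero by (rule app_in_vecs)

lemma app_piece:
  assumes "v \<in> piece (Suc k) s"
  shows "app (b (Suc k)) (A k) v \<in> piece k s"
proof -
  have "app (b (Suc k)) (A k) v = component k s (app (b (Suc k)) (A k) v)"
    using assms by (simp add: component_app component_piece)
  also have "\<dots> \<in> piece k s"
    using assms by (intro component_in_piece app_in_vecs_length) (simp add: piece_def)
  finally show ?thesis .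
qed

lemma aug_image': "aug ` vecs m (b 0) = semigroup_algebra S"
  using aug_image by (simp add: aug_def[abs_def])

lemma g_monom: "i < b 0 \<Longrightarrow> g ! i = Polynomial.monom (poly.coeff (g ! i) (e 0 ! i)) (e 0 ! i)"
  by (rule poly_eqI) (use g_deg in auto)

lemma coeff_subst_mult_g:
  assumes "i < b 0"
  shows "poly.coeff (subst d p * g ! i) s =
    (\<Sum>a | a \<in> keys p \<and> e 0 ! i + wdeg d a = s. lookup p a) * poly.coeff (g ! i) (e 0 ! i)"
proof -
  have eq: "subst d p * g ! i = Polynomial.monom (poly.coeff (g ! i) (e 0 ! i)) (e 0 ! i) * subst d p"
    by (subst g_monom[OF assms]) (rule mult.commute)
  have "{a \<in> keys p. e 0 ! i + wdeg d a = s} =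
      (if e 0 ! i \<le> s then {a \<in> keys p. wdeg d a = s - e 0 ! i} else {})"
    by auto
  then show ?thesis
    by (simp add: eq coeff_monom_mult coeff_subst)
qed

lemma coeff_aug_component: "poly.coeff (aug (component 0 s v)) s = poly.coeff (aug v) s"
  unfolding aug_def coeff_sum
proof (rule sum.cong[OF refl])
  fix i assume "i \<in> {..<b 0}"
  then have i: "i < b 0" by simp
  have "(\<Sum>a | a \<in> keys (component 0 s v i) \<and> e 0 ! i + wdeg d a = s. lookup (component 0 s v i) a) =
      (\<Sum>a | a \<in> keys (v i) \<and> e 0 ! i + wdeg d a = s. lookup (v i) a)"
    by (rule sum.cong) (auto simp: component_def keys_restr lookup_restr)
  then show "poly.coeff (subst d (component 0 s v i) * g ! i) s = poly.coeff (subst d (v i) * g ! i) s"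
    by (simp add: coeff_subst_mult_g[OF i])
qed

lemma coeff_aug_piece: "v \<in> piece 0 s \<Longrightarrow> t \<noteq> s \<Longrightarrow> poly.coeff (aug v) t = 0"
  unfolding aug_def coeff_sum by (rule sum.neutral) (auto simp: coeff_subst_mult_g piece_def intro!: sum.neutral)

text \<open>On a homogeneous element \<open>aug\<close> has at most one term, so its kernel is that
  of a linear functional.\<close>

lemma aug_piece_eq_0_iff: "v \<in> piece 0 s \<Longrightarrow> aug v = 0 \<longleftrightarrow> poly.coeff (aug v) s = 0"
  using coeff_aug_piece[of v s] by (metis coeff_0 poly_eqI)

lemma finite_basis_index:
  shows "finite (basis_index k s)"
  unfolding basis_index_def homogeneous_monomials using finite_monomials[of m d, OF d_pos] by auto

lemma card_basis_index:
  shows "card (basis_index k s) = (\<Sum>i<b k. if e k ! i \<le> s then card (monomials d m (s - e k ! i)) else 0)"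
  unfolding basis_index_def homogeneous_monomials
  using finite_monomials[of m d, OF d_pos] by (subst card_SigmaI) (auto intro!: sum.cong)

lemma piece_subset_span:
  shows "piece k s \<subseteq> vecs.span (unit_monomial ` basis_index k s)"
proof
  fix v assume v: "v \<in> piece k s"
  have "v = (\<Sum>x\<in>basis_index k s. scale_vec (lookup (v (fst x)) (snd x)) (unit_monomial x))"
  proof (intro ext poly_mapping_eqI)
    fix i a
    have "lookup (v i) a = 0" if "(i, a) \<notin> basis_index k s"
    proof (rule ccontr)
      assume "lookup (v i) a \<noteq> 0"
      then have "a \<in> keys (v i)" by (simp add: in_keys_iff)
      moreover have "i < b k"
        using v \<open>lookup (v i) a \<noteq> 0\<close> by (auto simp: piece_def vecs_def not_less[symmetric])
      ultimately show False
        using v that by (auto simp: piece_def vecs_def poly_ring_def basis_index_def)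
    qed
    then show "lookup (v i) a =
        lookup ((\<Sum>x\<in>basis_index k s. scale_vec (lookup (v (fst x)) (snd x)) (unit_monomial x)) i) a"
      using lookup_sum_unit_monomial[OF finite_basis_index,
          of "\<lambda>x. lookup (v (fst x)) (snd x)" k s i a]
      by auto
  qed
  also have "\<dots> \<in> vecs.span (unit_monomial ` basis_index k s)"
    by (intro vecs.span_sum vecs.span_scale vecs.span_base) auto
  finally show "v \<in> vecs.span (unit_monomial ` basis_index k s)" .
qed

lemma dim_piece:
  shows "vecs.dim (piece k s) = card (basis_index k s)"
proof (rule vecs.dim_unique[OF _ piece_subset_span])
  show "unit_monomial ` basis_index k s \<subseteq> piece k s"
    by (auto simp: basis_index_def piece_def vecs_def unit_monomial_def poly_ring_def split: if_splits)
  show "vecs.independent (unit_monomial ` basis_index k s :: (nat \<Rightarrow> 'k mpoly) set)"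
    using finite_basis_index by (rule independent_unit_monomials)
  show "card (unit_monomial ` basis_index k s :: (nat \<Rightarrow> 'k mpoly) set) = card (basis_index k s)"
    using inj_on_subset[OF inj_unit_monomial] by (rule card_image) simp
qed

text \<open>The augmentation plays the role of the differential leaving the module of index
  0.\<close>

definition cycles :: "nat \<Rightarrow> nat \<Rightarrow> (nat \<Rightarrow> 'k mpoly) set" where
  "cycles k s = {v \<in> piece k s. case k of 0 \<Rightarrow> aug v = 0 | Suc l \<Rightarrow> app (b k) (A l) v = 0}"

lemma cycles_0: "cycles 0 s = {v \<in> piece 0 s. aug v = 0}"
  by (simp add: cycles_def)

lemma cycles_Suc: "cycles (Suc k) s = {v \<in> piece (Suc k) s. app (b (Suc k)) (A k) v = 0}"
  by (simp add: cycles_def)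

text \<open>Exactness descends to each degree because the differentials commute with taking
  components.\<close>

lemma app_image_piece: "app (b (Suc k)) (A k) ` piece (Suc k) s = cycles k s"
proof
  have cycle: "v \<in> cycles k s \<longleftrightarrow> v \<in> piece k s \<and> v \<in> app (b (Suc k)) (A k) ` vecs m (b (Suc k))" for v
  proof (cases k)
    case 0
    then show ?thesis
      using aug_kernel by (auto simp: cycles_def aug_def piece_def)
  next
    case (Suc l)
    then show ?thesis
      unfolding Suc cycles_Suc exact[of l, symmetric] by (auto simp: piece_def)
  qed
  show "app (b (Suc k)) (A k) ` piece (Suc k) s \<subseteq> cycles k s"
  proof
    fix v assume "v \<in> app (b (Suc k)) (A k) ` piece (Suc k) s"
    then obtain u where u: "u \<in> piece (Suc k) s" "v = app (b (Suc k)) (A k) u" by blast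
    then have "u \<in> vecs m (b (Suc k))" by (simp add: piece_def)
    with u show "v \<in> cycles k s" unfolding cycle by (auto intro: app_piece)
  qed
  show "cycles k s \<subseteq> app (b (Suc k)) (A k) ` piece (Suc k) s"
  proof
    fix v assume "v \<in> cycles k s"
    then obtain u where u: "v \<in> piece k s" "u \<in> vecs m (b (Suc k))" "v = app (b (Suc k)) (A k) u"
      unfolding cycle by blast
    \<comment> \<open>The preimage \<open>u\<close> may be inhomogeneous, but its component of
      degree \<open>s\<close> already maps to \<open>v\<close>.\<close>
    then have "v = app (b (Suc k)) (A k) (component (Suc k) s u)"
      using component_app[of k s u] by (simp add: component_piece)
    then show "v \<in> app (b (Suc k)) (A k) ` piece (Suc k) s"
      using component_in_piece[OF u(2)] by blast
  qed
qed

lemma dim_piece_Suc: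
  shows "vecs.dim (piece (Suc k) s) = vecs.dim (cycles (Suc k) s) + vecs.dim (cycles k s)"
proof -
  have "Vector_Spaces.linear scale_vec scale_vec (app (b (Suc k)) (A k))"
  proof (unfold_locales)
    show "app (b (Suc k)) (A k) (u + v) = app (b (Suc k)) (A k) u + app (b (Suc k)) (A k) v" for u v
      using app_add[of "b (Suc k)" "A k" u v] by (simp add: plus_fun_def)
    show "app (b (Suc k)) (A k) (scale_vec c v) = scale_vec c (app (b (Suc k)) (A k) v)" for c v
      by (simp add: scale_vec_def app_scale)
  qed
  from vecs_pair.dim_kernel_image[OF this subspace_piece _ piece_subset_span]
  show ?thesis
    using finite_basis_index by (simp add: app_image_piece cycles_Suc)
qed

text \<open>Rank-nullity for the coefficient of degree \<open>s\<close> of \<open>aug\<close>, whose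
  image is the whole field if \<open>s\<close> lies in \<open>S\<close> and zero otherwise.\<close>

lemma dim_piece_0:
  shows "vecs.dim (piece 0 s) = vecs.dim (cycles 0 s) + (if s \<in> S then 1 else 0)"
proof -
  let ?f = "\<lambda>v. poly.coeff (aug v) s"
  have scale: "?f (scale_vec c v) = c * ?f v" for c v
    by (simp add: aug_def scale_vec_def subst_single_mult wdeg_def monom_0 coeff_sum sum_distrib_left)
  have lin: "Vector_Spaces.linear scale_vec (*) ?f"
  proof (unfold_locales)
    show "?f (u + v) = ?f u + ?f v" for u v
      by (simp add: aug_def subst_add distrib_right sum.distrib)
  qed (rule scale)
  have "vecs_field.vs2.dim (?f ` piece 0 s) = (if s \<in> S then 1 else 0)"
  proof (cases "s \<in> S")
    case True
    then have "(Polynomial.monom 1 s :: 'k poly) \<in> semigroup_algebra S"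
      by (simp add: semigroup_algebra_def)
    then have "Polynomial.monom 1 s \<in> aug ` vecs m (b 0)"
      by (simp only: aug_image')
    then obtain v where v: "v \<in> vecs m (b 0)" "aug v = Polynomial.monom 1 s"
      by (elim imageE) simp
    let ?v = "component 0 s v"
    have "?v \<in> piece 0 s" using v(1) by (rule component_in_piece)
    moreover have "?f ?v = 1" by (simp add: coeff_aug_component v(2))
    ultimately have "c \<in> ?f ` piece 0 s" for c
      using vecs.subspace_scale[OF subspace_piece, of ?v 0 s c] scale[of c ?v]
      by (intro image_eqI[of _ _ "scale_vec c ?v"]) auto
    then have "?f ` piece 0 s = UNIV" by auto
    moreover have "vecs_field.vs2.dim (UNIV :: 'k set) = 1"
    proof (rule vecs_field.vs2.dim_unique[of "{1}"])
      show "(UNIV :: 'k set) \<subseteq> vecs_field.vs2.span {1}"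
        by (auto simp: vecs_field.vs2.span_singleton)
      show "vecs_field.vs2.independent {1 :: 'k}"
        by (rule vecs_field.vs2.independent_if_scalars_zero) auto
    qed auto
    ultimately show ?thesis using True by simp
  next
    case False
    have "?f v = 0" if "v \<in> piece 0 s" for v
    proof -
      have "aug v \<in> semigroup_algebra S"
        using that unfolding aug_image'[symmetric] by (auto simp: piece_def)
      with False show ?thesis by (auto simp: semigroup_algebra_def)
    qed
    then have "?f ` piece 0 s \<subseteq> {0}" by auto
    then have "vecs_field.vs2.dim (?f ` piece 0 s) = 0"
      by (intro vecs_field.vs2.dim_unique[of "{}"]) (auto simp: vecs_field.vs2.independent_empty)
    with False show ?thesis by simp
  qed
  moreover have "cycles 0 s = {v \<in> piece 0 s. ?f v = 0}"
    by (auto simp: cycles_0 aug_piece_eq_0_iff)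
  ultimately show ?thesis
    using vecs_field.dim_kernel_image[OF lin subspace_piece _ piece_subset_span]
      finite_basis_index by simp
qed

section \<open>Euler characteristic and Euler polynomial of a finite resolution\<close>

lemma euler_characteristic:
  assumes "e (Suc N) = []"
  shows "(\<Sum>k\<le>N. (-1) ^ k * int (card (basis_index k s))) = (if s \<in> S then 1 else 0)"
proof -
  \<comment> \<open>As the next module is zero, no cycles are left at \<open>N\<close>, and the
    telescoped sum has no remainder.\<close>
  have "piece (Suc N) s \<subseteq> {0}"
    by (auto simp: piece_def vecs_def assms)
  then have "vecs.dim (piece (Suc N) s) = 0"
    by (intro vecs.dim_unique[of "{}"]) (auto simp: vecs.independent_empty)
  then have "vecs.dim (cycles N s) = 0"
    using dim_piece_Suc[of N s] by simp
  moreover have "(\<Sum>k\<le>N. (-1) ^ k * int (vecs.dim (piece k s))) =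
      (if s \<in> S then 1 else 0) + (-1) ^ N * int (vecs.dim (cycles N s))"
    by (rule alternating_sum_telescope)
      (simp_all add: dim_piece_0 dim_piece_Suc)
  ultimately show ?thesis by (simp add: dim_piece)
qed

text \<open>Dimension counts are integers, so the identity can be read over the complex numbers
  whatever the field is. A basis element of degree \<open>j\<close> shifts the series of the ring by
  \<open>j\<close>.\<close>

lemma euler_series:
  assumes "e (Suc N) = []"
  shows "fps_of_poly (\<Sum>k\<le>N. \<Sum>i<b k. Polynomial.monom ((-1) ^ k) (e k ! i)) * monomial_series d m
    = (indicator_series S :: complex fps)"
proof (rule fps_ext)
  fix s
  let ?c = "\<lambda>k i. if e k ! i \<le> s then of_nat (card (monomials d m (s - e k ! i))) else (0 :: complex)"
  have "fps_nth (fps_of_poly (\<Sum>k\<le>N. \<Sum>i<b k. Polynomial.monom ((-1) ^ k) (e k ! i)) * monomial_series d m) s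
      = (\<Sum>k\<le>N. \<Sum>i<b k. (-1) ^ k * ?c k i)"
    unfolding fps_of_poly_sum sum_distrib_right fps_sum_nth fps_of_poly_monom
    by (intro sum.cong refl)
      (auto simp: mult.assoc fps_X_power_mult_nth monomial_series_def not_less)
  also have "\<dots> = (\<Sum>k\<le>N. (-1) ^ k * of_nat (card (basis_index k s)))"
  proof (intro sum.cong refl)
    fix k
    have "card (basis_index k s) = (\<Sum>i<b k. if e k ! i \<le> s then card (monomials d m (s - e k ! i)) else 0)"
      by (rule card_basis_index)
    then have "of_nat (card (basis_index k s)) = (\<Sum>i<b k. ?c k i)"
      by (simp add: if_distrib cong: if_cong)
    then show "(\<Sum>i<b k. (-1) ^ k * ?c k i) = (-1) ^ k * of_nat (card (basis_index k s))"
      by (simp only: sum_distrib_left)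
  qed
  also have "\<dots> = of_int (\<Sum>k\<le>N. (-1) ^ k * int (card (basis_index k s)))"
    by simp
  also have "\<dots> = fps_nth (indicator_series S) s"
    unfolding euler_characteristic[OF assms] by (simp add: indicator_series_def)
  finally show "fps_nth (fps_of_poly (\<Sum>k\<le>N. \<Sum>i<b k. Polynomial.monom ((-1) ^ k) (e k ! i)) *
      monomial_series d m) s = (fps_nth (indicator_series S) s :: complex)" .
qed

text \<open>The factor belonging to \<open>l\<close> is spent on turning the Hilbert series into a
  polynomial \<open>F\<close>; the other factors remain.\<close>

lemma prod_dvd_euler_polynomial:
  assumes N: "e (Suc N) = []"
    and l: "l \<in> {1..m}" and S: "\<And>s. s \<in> S \<Longrightarrow> s + d l \<in> S"
  shows "(\<Prod>j\<in>{1..m} - {l}. 1 - Polynomial.monom 1 (d j)) dvd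
    (\<Sum>k\<le>N. \<Sum>i<b k. Polynomial.monom ((-1) ^ k) (e k ! i) :: complex poly)"
proof -
  let ?P = "\<Sum>k\<le>N. \<Sum>i<b k. Polynomial.monom ((-1) ^ k) (e k ! i) :: complex poly"
  let ?Q = "\<Prod>j\<in>{1..m} - {l}. 1 - Polynomial.monom 1 (d j) :: complex poly"
  obtain F :: "complex poly" where F: "(1 - fps_X ^ d l) * indicator_series S = fps_of_poly F"
    using indicator_series_polynomial[OF d_pos[OF l] S] by blast
  have fps: "fps_of_poly (1 - Polynomial.monom 1 n) = (1 - fps_X ^ n :: complex fps)" for n
    by (simp add: fps_of_poly_diff fps_of_poly_monom)
  have "fps_of_poly ?P = fps_of_poly ?P * ((\<Prod>i=1..m. 1 - fps_X ^ d i) * monomial_series d m)"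
    by (simp only: prod_monomial_series[of m d, OF d_pos] mult_1_right)
  also have "\<dots> = indicator_series S * (\<Prod>i=1..m. 1 - fps_X ^ d i)"
    by (subst euler_series[OF N, symmetric]) (simp_all add: mult_ac)
  also have "(\<Prod>i=1..m. 1 - fps_X ^ d i) = (1 - fps_X ^ d l) * fps_of_poly ?Q"
    using l by (subst prod.remove[of _ l]) (simp_all add: fps_of_poly_prod fps)
  also have "indicator_series S * \<dots> = fps_of_poly (F * ?Q)"
    unfolding fps_of_poly_mult F[symmetric] by (simp add: mult_ac)
  finally have "?P = F * ?Q" by (simp only: fps_of_poly_eq_iff)
  then show ?thesis by simp
qed

end

section \<open>From basis degrees to Betti numbers, and the vanishing of the weighted sums\<close>

lemma sum_betti:
  "(\<Sum>j\<in>{j. betti e k j \<noteq> 0}. of_nat (betti e k j) * f j) = (\<Sum>i<length (e k). f (e k ! i) :: complex)"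
proof -
  have "(\<Sum>j\<in>{j. betti e k j \<noteq> 0}. of_nat (betti e k j) * f j) =
      (\<Sum>j\<in>{j. betti e k j \<noteq> 0}. \<Sum>i | i \<in> {..<length (e k)} \<and> e k ! i = j. f (e k ! i))"
    by (intro sum.cong refl) (simp add: betti_def)
  also have "\<dots> = (\<Sum>i<length (e k). f (e k ! i))"
    \<comment> \<open>Basis elements are grouped by their degree.\<close>
    by (rule sum.group[OF _ finite_betti_support]) (auto simp: betti_def card_eq_0_iff)
  finally show ?thesis .
qed

lemma generated_add:
  assumes "s \<in> generated d I" "finite I" "l \<in> I"
  shows "s + d l \<in> generated d I"
proof -
  obtain a where a: "s = (\<Sum>i\<in>I. a i * d i)" using assms(1) by (auto simp: generated_def)
  have "s + d l = (\<Sum>i\<in>I. (a i + (if i = l then 1 else 0)) * d i)"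
    using assms(2,3) by (simp add: a distrib_right sum.distrib if_distrib[of "\<lambda>x. x * _"] cong: if_cong)
  then show ?thesis
    unfolding generated_def by (intro CollectI exI[of _ "\<lambda>i. a i + (if i = l then 1 else 0)"]) simp
qed

theorem theorem2p2:
  fixes d :: "nat \<Rightarrow> nat" and m q r :: nat and n :: int and S :: "nat set"
    and e :: "nat \<Rightarrow> nat list" and D :: "nat \<Rightarrow> 'k::field mpoly mat" and g :: "'k poly list"
  assumes "minimally_generates d m S"
    and "strict_mono_on {1..m} d"
    and "Gcd (d ` {1..m}) = 1"
    and "minimal_graded_free_resolution d m S e D g"
    and "1 \<le> q" and "q \<le> d m"
    and "coprime n (int q)"
    and "0 < w d m q"
    and "r < w d m q"
    and "\<not> (q = 1 \<and> r = m - 1)"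
  shows "(\<Sum>k = 0..m - 1. \<Sum>j\<in>{j. betti e k j \<noteq> 0}.
            (-1) ^ k * of_nat (betti e k j) * of_nat j ^ r *
            exp (\<i> * (2 * of_real pi * of_int n / of_nat q) * of_nat j)) = (0 :: complex)"
proof -
  have d: "0 < d i" if "i \<in> {1..m}" for i
    using that assms(1) by (simp add: minimally_generates_def)
  interpret resolution d m S e "\<lambda>k. mat_fun (D k)" g
    using d assms(4) by (intro graded_free_resolution_imp_resolution)
      (simp_all add: minimal_graded_free_resolution_def)
  have S: "s + d l \<in> S" if "s \<in> S" "l \<in> {1..m}" for s l
    using that assms(1) by (auto simp: minimally_generates_def intro: generated_add)
  have "m \<noteq> 0"
    using assms(8) by (cases m) (auto simp: w_def)
  then obtain M where M: "m = Suc M" by (cases m) auto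
  have dims: "dim_row (D k) = length (e k)" "dim_col (D k) = length (e (Suc k))" for k
    using assms(4)
    by (auto simp: minimal_graded_free_resolution_def graded_free_resolution_def graded_matrix_def)
  have "mat_fun (D k) i j \<in> irrelevant_ideal m" for k i j
    using assms(4)
    by (auto simp: mat_fun_def dims minimal_graded_free_resolution_def irrelevant_ideal_def)
  \<comment> \<open>Hence summing up to \<open>m - 1\<close> covers the whole resolution.\<close>
  then have N: "e (Suc (m - 1)) = []"
    by (intro length_le[OF _ M]) (simp_all add: M)
  define z :: complex where "z = exp (\<i> * (2 * of_real pi * of_int n / of_nat q))"
  have "of_nat q * (\<i> * (2 * of_real pi * of_int n / of_nat q)) = \<i> * of_real (2 * pi * of_int n)"
    using assms(5) by simp
  then have zq: "z ^ q = 1"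
    unfolding z_def exp_of_nat_mult[symmetric]
    by (simp only: cis_conv_exp[symmetric] cis_multiple_2pi Ints_of_int)
  have z_power: "z ^ j = exp (\<i> * (2 * of_real pi * of_int n / of_nat q) * of_nat j)" for j
    unfolding z_def exp_of_nat_mult[symmetric] by (rule arg_cong[OF mult.commute])
  \<comment> \<open>For \<open>q = 1\<close> every index counts, so omitting one lowers the order to
    \<open>m - 1\<close>, which still exceeds \<open>r\<close>. For other \<open>q\<close> the gcd
    condition yields an \<open>l\<close> whose omission costs nothing.\<close>
  obtain l where l: "l \<in> {1..m}" "r < card {j \<in> {1..m} - {l}. q dvd d j}"
  proof (cases "q = 1")
    case True
    then have "{l \<in> {1..m}. q dvd d l} = {1..m}" by auto
    then have "w d m q = m" by (simp only: w_def) simp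
    then have "r < card ({1..m} - {m})" using True assms(9,10) \<open>m \<noteq> 0\<close> by simp
    moreover have "{j \<in> {1..m} - {m}. q dvd d j} = {1..m} - {m}" using True by auto
    ultimately have "r < card {j \<in> {1..m} - {m}. q dvd d j}" by (simp only:)
    then show ?thesis by (rule that[rotated]) (use \<open>m \<noteq> 0\<close> in simp)
  next
    case False
    have "\<exists>l\<in>{1..m}. \<not> q dvd d l"
    proof (rule ccontr)
      assume "\<not> (\<exists>l\<in>{1..m}. \<not> q dvd d l)"
      then have "q dvd Gcd (d ` {1..m})" by (intro Gcd_greatest) auto
      with False assms(3) show False by simp
    qed
    then obtain l where l: "l \<in> {1..m}" "\<not> q dvd d l" by blast
    then have "{j \<in> {1..m} - {l}. q dvd d j} = {j \<in> {1..m}. q dvd d j}" by blast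
    with l assms(9) show ?thesis by (intro that[of l]) (simp_all add: w_def)
  qed
  \<comment> \<open>Flattening the double sum matches the single index set of
    \<open>weighted_sum_eq_0\<close>.\<close>
  let ?I = "SIGMA k:{..m - 1}. {..<length (e k)}"
  have "[:- z, 1:] ^ Suc r dvd [:- z, 1:] ^ card {j \<in> {1..m} - {l}. q dvd d j}"
    using l(2) by (intro le_imp_power_dvd) simp
  also have "\<dots> dvd (\<Prod>j\<in>{1..m} - {l}. 1 - Polynomial.monom 1 (d j))"
    using zq by (rule power_dvd_prod_one_minus_monom) simp
  also have "\<dots> dvd (\<Sum>k\<le>m - 1. \<Sum>i<length (e k). Polynomial.monom ((-1) ^ k) (e k ! i))"
    using N l(1) S[OF _ l(1)] by (rule prod_dvd_euler_polynomial)
  also have "\<dots> = (\<Sum>x\<in>?I. Polynomial.monom ((-1) ^ fst x) (e (fst x) ! snd x))"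
    by (simp add: sum.Sigma case_prod_unfold)
  finally have "(\<Sum>x\<in>?I. (-1) ^ fst x * of_nat (e (fst x) ! snd x) ^ r * z ^ (e (fst x) ! snd x)) = 0"
    by (rule weighted_sum_eq_0)
  also have "(\<Sum>x\<in>?I. (-1) ^ fst x * of_nat (e (fst x) ! snd x) ^ r * z ^ (e (fst x) ! snd x)) =
      (\<Sum>k\<le>m - 1. \<Sum>i<length (e k). (-1) ^ k * of_nat (e k ! i) ^ r * z ^ (e k ! i))"
    by (simp add: sum.Sigma case_prod_unfold)
  also have "\<dots> = (\<Sum>k\<le>m - 1. \<Sum>j\<in>{j. betti e k j \<noteq> 0}.
      of_nat (betti e k j) * ((-1) ^ k * of_nat j ^ r * z ^ j))"
    by (simp only: sum_betti)
  also have "\<dots> = (\<Sum>k = 0..m - 1. \<Sum>j\<in>{j. betti e k j \<noteq> 0}.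
            (-1) ^ k * of_nat (betti e k j) * of_nat j ^ r *
            exp (\<i> * (2 * of_real pi * of_int n / of_nat q) * of_nat j))"
    unfolding z_power atMost_atLeast0 by (intro sum.cong refl) (simp only: mult_ac)
  finally show ?thesis .
qed

end
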